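(* Let $(X_t)_{t\ge 0}$, $(\mathbb{P}_x)_{x\in E}$ be an irreducible Markov jump process on the finite set $E$ with invariant distribution $\pi$ and generator $L$, let $f:E\to\mathbb{R}$ be non-constant with $\pi(f)=0$, let $\nu$ be a probability measure on $E$, and let $A_t=\int_0^t f(X_s)\,ds$ for $t>0$. Let $u\ge0$, and define $$r_0:=\frac{\lambda_1}{2\|f\|_\infty}\left(1-\left(1+\frac{4u\|f\|_\infty}{\lambda_1\hat\sigma_f^2}\right)^{-1/2}\right),\qquad G(r):=\frac{r^2\,\hat\sigma_f^2/2}{1-2\left(\frac{\|f\|_\infty}{\lambda_1}\right)r}\quad\text{for }0\le r<\frac{\lambda_1}{2\|f\|_\infty},$$ and $G^*(u):=\sup_{r\in[0,\lambda_1/(3\|f\|_\infty)]}(ru-G(r))$. Then: (a) If $r_0\le\frac{\lambda_1}{3\|f\|_\infty}$, or equivalently $u\le\frac{2\hat\sigma_f^2\lambda_1}{\|f\|_\infty}$, then $G^*(u)=r_0u-G(r_0)$ and consequently $$\mathbb{P}_\nu\left(\frac{A_t}{t}\ge u\right)\le\left\|\frac{d\nu}{d\pi}\right\|_2\exp\left(-\frac{2tu^2}{\hat\sigma_f^2\left(1+\sqrt{1+\frac{4\|f\|_\infty u}{\lambda_1\hat\sigma_f^2}}\right)^2}\right).$$ (b) If $r_0>\frac{\lambda_1}{3\|f\|_\infty}$, or equivalently $u>\frac{2\hat\sigma_f^2\lambda_1}{\|f\|_\infty}$, then $G^*(u)=\frac{\lambda_1}{3\|f\|_\infty}u-G\left(\frac{\lambda_1}{3\|f\|_\infty}\right)$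 and consequently $$\mathbb{P}_\nu\left(\frac{A_t}{t}\ge u\right)\le\left\|\frac{d\nu}{d\pi}\right\|_2\exp\left(-t\,\frac{\lambda_1}{3\|f\|_\infty}\left(u-\frac{\lambda_1\hat\sigma_f^2}{2\|f\|_\infty}\right)\right).$$
   Context: $E$ is a finite set with at least two elements. A Markov jump process (MJP) on $E$ is an $E$-valued process $(X_t)_{t\ge0}$ with right-continuous (piecewise constant) paths together with probability measures $(\mathbb{P}_x)_{x\in E}$ such that $\mathbb{P}_x(X_0=x)=1$ and the (time-homogeneous) Markov property holds. Its transition function is $p_{xy}(t)=\mathbb{P}_x(X_t=y)=(\exp(tQ))_{xy}$ for a unique matrix $Q=(q_{xy})$ with $q_{xy}\ge0$ for $x\ne y$ and $\sum_y q_{xy}=0$. It is irreducible if $p_{xy}(t)>0$ for all $x,y\in E$, $t>0$; then it has a unique invariant distribution $\pi$ ($\pi^TQ=0$), and $\pi_x>0$ for all $x$. Write $\mathbb{P}_\nu=\sum_x\nu_x\mathbb{P}_x$ for a probability measure $\nu$ on $E$, and $\mu(g)=\int g\,d\mu$. $L^2(\pi)$ is the real space of all functions $E\to\mathbb{R}$ with inner product $\langle g,h\rangle=\sum_x g(x)h(x)\pi_x$ and norm $\|\cdot\|_2$; $\|f\|_\infty=\max_x|f(x)|$. The infinitesimal generator $L$ is the operator on $L^2(\pi)$ given by $(Lg)(x)=\sum_y q_{xy}g(y)$, and $L^*$ is its adjoint in $L^2(\pi)$. $\frac{d\nu}{d\pi}(x)=\nu_x/\pi_x$. The self-adjoint operator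 $\frac{L+L^*}{2}$ is negative semidefinite with simple eigenvalue $0$ (eigenspace: constants). Its spectral gap is $\lambda_1:=\min\{|\lambda|:\lambda\in\sigma(\frac{L+L^*}{2})\setminus\{0\}\}>0$. $S$ denotes the reduced resolvent of $\frac{L+L^*}{2}$ with respect to the eigenvalue $0$, i.e. $S=0$ on constants and $S$ is the inverse of $\frac{L+L^*}{2}$ restricted to the orthogonal complement of the constants. Finally $\hat\sigma_f^2:=-2\langle f,Sf\rangle$. *)

theory Defs
  imports "HOL-Probability.Probability"
begin

section \<open>Markov jump processes on a finite state space\<close>

text \<open>
  The state space is a finite type \<open>'e\<close>. A process is a family \<open>X t\<close> (\<open>t \<ge> 0\<close>) of maps on the
  measurable space \<open>M\<close>; \<open>P x\<close> is the law started at \<open>x\<close>. Times are reals, and only the values at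
  \<open>t \<ge> 0\<close> are constrained.
\<close>

text \<open>Right-continuous for the discrete topology on \<open>'e\<close>, with finitely many jumps in bounded time.\<close>

definition jump_path :: "(real \<Rightarrow> 'e) \<Rightarrow> bool" where
  "jump_path w \<longleftrightarrow>
     (\<forall>t\<ge>0. \<forall>\<^sub>F s in at_right t. w s = w t) \<and>
     (\<forall>T. finite {t \<in> {0<..T}. \<not> (\<forall>\<^sub>F s in at_left t. w s = w t)})"

definition natural_filtration :: "'w measure \<Rightarrow> (real \<Rightarrow> 'w \<Rightarrow> 'e) \<Rightarrow> real \<Rightarrow> 'w measure" where
  "natural_filtration M X s =
     sigma (space M) {X r -` A \<inter> space M | r A. 0 \<le> r \<and> r \<le> s}"

definition transition_fun ::
  "('e \<Rightarrow> 'w measure) \<Rightarrow> (real \<Rightarrow> 'w \<Rightarrow> 'e) \<Rightarrow> real \<Rightarrow> 'e \<Rightarrow> 'e \<Rightarrow> real" where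
  "transition_fun P X t x y = measure (P x) {\<omega> \<in> space (P x). X t \<omega> = y}"

locale markov_jump_process =
  fixes M :: "'w measure" and P :: "'e::finite \<Rightarrow> 'w measure" and X :: "real \<Rightarrow> 'w \<Rightarrow> 'e"
  assumes prob_space_P: "\<And>x. prob_space (P x)"
    and sets_P: "\<And>x. sets (P x) = sets M"
    and measurable_X: "\<And>t. 0 \<le> t \<Longrightarrow> X t \<in> measurable M (count_space UNIV)"
    and jump_paths: "\<And>\<omega>. \<omega> \<in> space M \<Longrightarrow> jump_path (\<lambda>t. X t \<omega>)"
    and initial: "\<And>x. measure (P x) {\<omega> \<in> space M. X 0 \<omega> = x} = 1"
    and Markov: "\<And>x y s t. 0 \<le> s \<Longrightarrow> 0 \<le> t \<Longrightarrow>
       AE \<omega> in P x.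
         real_cond_exp (P x) (natural_filtration M X s)
           (indicator {\<omega> \<in> space M. X (s + t) \<omega> = y}) \<omega>
         = transition_fun P X t (X s \<omega>) y"

definition irreducible_process ::
  "('e \<Rightarrow> 'w measure) \<Rightarrow> (real \<Rightarrow> 'w \<Rightarrow> 'e) \<Rightarrow> bool" where
  "irreducible_process P X \<longleftrightarrow> (\<forall>t>0. \<forall>x y. transition_fun P X t x y > 0)"

text \<open>Measure of a set under \<open>\<Sum>x. \<nu> x * P x\<close>.\<close>

definition prob_from :: "('e::finite \<Rightarrow> 'w measure) \<Rightarrow> 'e pmf \<Rightarrow> 'w set \<Rightarrow> real" where
  "prob_from P \<nu> A = (\<Sum>x\<in>UNIV. pmf \<nu> x * measure (P x) A)"

text \<open>The additive functional \<open>A t = \<integral>\<^sub>0\<^sup>t f (X s) ds\<close>. Functions on \<open>'e\<close> are vectors in \<open>real ^ 'e\<close>.\<close>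

definition additive_functional ::
  "(real \<Rightarrow> 'w \<Rightarrow> 'e::finite) \<Rightarrow> real ^ 'e \<Rightarrow> real \<Rightarrow> 'w \<Rightarrow> real" where
  "additive_functional X f t \<omega> = integral {0..t} (\<lambda>s. f $ X s \<omega>)"


section \<open>Generator matrix and invariant distribution\<close>

definition matrix_exp :: "real ^ 'e ^ 'e \<Rightarrow> real ^ 'e ^ 'e" where
  "matrix_exp A = (\<Sum>n. (1 / fact n) *\<^sub>R (((**) A ^^ n) (mat 1)))"

text \<open>
  This determines \<open>Q\<close>: it is the derivative at \<open>0\<close> of the transition function. The generator \<open>L\<close>
  is the operator \<open>(*v) Q\<close>.
\<close>

definition generator_matrix ::
  "('e::finite \<Rightarrow> 'w measure) \<Rightarrow> (real \<Rightarrow> 'w \<Rightarrow> 'e) \<Rightarrow> real ^ 'e ^ 'e \<Rightarrow> bool" where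
  "generator_matrix P X Q \<longleftrightarrow>
     (\<forall>x y. x \<noteq> y \<longrightarrow> Q $ x $ y \<ge> 0) \<and>
     (\<forall>x. (\<Sum>y\<in>UNIV. Q $ x $ y) = 0) \<and>
     (\<forall>t\<ge>0. \<forall>x y. transition_fun P X t x y = matrix_exp (t *\<^sub>R Q) $ x $ y)"

definition invariant_distribution :: "real ^ 'e ^ 'e \<Rightarrow> 'e::finite pmf \<Rightarrow> bool" where
  "invariant_distribution Q \<pi> \<longleftrightarrow> (\<forall>y. (\<Sum>x\<in>UNIV. pmf \<pi> x * Q $ x $ y) = 0)"


section \<open>The space \<open>L\<^sup>2(\<pi>)\<close> and operators on it\<close>

definition mean :: "'e::finite pmf \<Rightarrow> real ^ 'e \<Rightarrow> real" where
  "mean \<pi> g = measure_pmf.expectation \<pi> (\<lambda>x. g $ x)"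

definition inner_pi :: "'e::finite pmf \<Rightarrow> real ^ 'e \<Rightarrow> real ^ 'e \<Rightarrow> real" where
  "inner_pi \<pi> g h = (\<Sum>x\<in>UNIV. g $ x * h $ x * pmf \<pi> x)"

definition norm_pi :: "'e::finite pmf \<Rightarrow> real ^ 'e \<Rightarrow> real" where
  "norm_pi \<pi> g = sqrt (inner_pi \<pi> g g)"

definition density_wrt :: "'e::finite pmf \<Rightarrow> 'e pmf \<Rightarrow> real ^ 'e" where
  "density_wrt \<nu> \<pi> = (\<chi> x. pmf \<nu> x / pmf \<pi> x)"

text \<open>The constant \<^const>\<open>adjoint\<close> refers to the unweighted inner product; this is its analogue for
  \<^const>\<open>inner_pi\<close>.\<close>

definition adjoint_pi ::
  "'e::finite pmf \<Rightarrow> (real ^ 'e \<Rightarrow> real ^ 'e) \<Rightarrow> real ^ 'e \<Rightarrow> real ^ 'e" where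
  "adjoint_pi \<pi> T = (SOME T'. \<forall>g h. inner_pi \<pi> (T g) h = inner_pi \<pi> g (T' h))"

definition symmetric_part ::
  "'e::finite pmf \<Rightarrow> (real ^ 'e \<Rightarrow> real ^ 'e) \<Rightarrow> real ^ 'e \<Rightarrow> real ^ 'e" where
  "symmetric_part \<pi> T g = (1 / 2) *\<^sub>R (T g + adjoint_pi \<pi> T g)"

text \<open>Real spectrum; for the self-adjoint operators considered here it is the whole spectrum.\<close>

definition spectrum :: "(real ^ 'e \<Rightarrow> real ^ 'e) \<Rightarrow> real set" where
  "spectrum T = {l. \<not> bij (\<lambda>g. T g - l *\<^sub>R g)}"

definition spectral_gap :: "'e::finite pmf \<Rightarrow> real ^ 'e ^ 'e \<Rightarrow> real" where
  "spectral_gap \<pi> Q = Min (abs ` (spectrum (symmetric_part \<pi> ((*v) Q)) - {0}))"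

text \<open>
  \<open>{h. mean \<pi> h = 0}\<close> is the orthogonal complement of the constants, and \<open>g - mean \<pi> g\<close> the
  orthogonal projection of \<open>g\<close> onto it. So this operator is the inverse of the restriction of \<open>K\<close> to
  the complement, extended by \<open>0\<close> on the constants.
\<close>

definition reduced_resolvent ::
  "'e::finite pmf \<Rightarrow> (real ^ 'e \<Rightarrow> real ^ 'e) \<Rightarrow> real ^ 'e \<Rightarrow> real ^ 'e" where
  "reduced_resolvent \<pi> K g = inv_into {h. mean \<pi> h = 0} K (g - (\<chi> x. mean \<pi> g))"

definition sigma_hat_sq :: "'e::finite pmf \<Rightarrow> real ^ 'e ^ 'e \<Rightarrow> real ^ 'e \<Rightarrow> real" where
  "sigma_hat_sq \<pi> Q f =
     - 2 * inner_pi \<pi> f (reduced_resolvent \<pi> (symmetric_part \<pi> ((*v) Q)) f)"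


section \<open>The rate function\<close>

text \<open>In this section \<open>l\<close> is the spectral gap, \<open>F\<close> the supremum norm of \<open>f\<close>, and \<open>v\<close> is \<open>\<sigma>\<^sup>2\<close>.
  The formula for \<open>G_fun\<close> is meant for \<open>0 \<le> r < l / (2 * F)\<close>.\<close>

definition r_zero :: "real \<Rightarrow> real \<Rightarrow> real \<Rightarrow> real \<Rightarrow> real" where
  "r_zero l F v u = l / (2 * F) * (1 - (1 + 4 * u * F / (l * v)) powr (- 1 / 2))"

definition G_fun :: "real \<Rightarrow> real \<Rightarrow> real \<Rightarrow> real \<Rightarrow> real" where
  "G_fun l F v r = (r\<^sup>2 * v / 2) / (1 - 2 * (F / l) * r)"

definition G_star :: "real \<Rightarrow> real \<Rightarrow> real \<Rightarrow> real \<Rightarrow> real" where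
  "G_star l F v u = (SUP r\<in>{0..l / (3 * F)}. r * u - G_fun l F v r)"

end

theory Submission
  imports Defs
begin

text \<open>
  Write \<open>K\<close> for the symmetric part of the generator in \<open>L\<^sup>2(\<pi>)\<close>, \<open>l\<close> for its spectral gap, \<open>S\<close> for
  its reduced resolvent, \<open>F\<close> for the supremum norm of \<open>f\<close> and \<open>\<sigma>\<^sup>2\<close> for \<^const>\<open>sigma_hat_sq\<close>.
  By Chernoff's inequality it is enough to bound exponential moments,

    \<open>E\<^sub>\<nu> exp (r A\<^sub>t) \<le> \<parallel>d\<nu>/d\<pi>\<parallel>\<^sub>2 exp (t G(r))\<close>  for \<open>0 \<le> r < l / (2 F)\<close>,

  and then to optimise over \<open>r\<close>.

  The moment is \<open>\<langle>d\<nu>/d\<pi>, exp (t (Q + r f)) 1\<rangle>\<close> by the Feynman-Kac formula, so what has to be shown is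
  that the quadratic form of \<open>Q + r f\<close>, which is that of \<open>K + r f\<close>, is at most \<open>G(r)\<close> on the unit sphere
  (\<open>tilted_form_le\<close>). For \<open>g = a + h\<close> with \<open>h\<close> centered the form is
  \<open>\<langle>h, K h\<rangle> + 2 r a \<langle>f, h\<rangle> + r \<langle>f h, h\<rangle>\<close>. The spectral gap bounds the last term by a multiple of \<open>- \<langle>h, K h\<rangle>\<close>. The middle term equals
  \<open>2 r a \<langle>K S f, h\<rangle>\<close>, so completing the square in the Dirichlet form leaves a multiple of
  \<open>- r\<^sup>2 a\<^sup>2 \<langle>f, S f\<rangle> = r\<^sup>2 a\<^sup>2 \<sigma>\<^sup>2 / 2\<close>.

  The Feynman-Kac formula is replaced by its discretisation. The Markov property on a grid of mesh
  \<open>h = t / n\<close> turns the exponential moment of a Riemann sum of \<open>r A\<^sub>t\<close> into \<open>(T\<^sub>h)^n 1\<close>, where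
  \<open>T\<^sub>h = exp (h Q) exp (h r f) = 1 + h (Q + r f) + O(h\<^sup>2)\<close> (\<open>exponential_moment_Riemann_sum\<close>). The form
  bound gives \<open>\<parallel>T\<^sub>h\<parallel> \<le> 1 + h G(r) + O(h\<^sup>2)\<close> (\<open>norm_pi_tilted_step_le\<close>), whose \<open>n\<close>-th power is
  \<open>exp (t G(r) + O(1/n))\<close>. Riemann sums converge because the paths are right-continuous, and they are
  bounded, so that the exponential moments converge too.

  The spectral gap inequality is obtained from a minimiser of the Dirichlet form on the centered unit
  sphere, which is an eigenvector (\<open>smallest_nonzero_eigenvalue\<close>). Finally the optimisation over \<open>r\<close>
  becomes elementary in the variable \<open>x = 1 - 2 r F / l\<close> (\<open>objective_eq\<close>).
\<close>


section \<open>The Dirichlet form of an ergodic generator\<close>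

text \<open>An isometry of \<open>L\<^sup>2(\<pi>)\<close> into the Euclidean space \<open>real ^ 'e\<close>: it makes the Euclidean
  Cauchy-Schwarz and triangle inequalities and the theory of orthogonal sets available for
  \<^const>\<open>inner_pi\<close>.\<close>

definition euclidean_embedding :: "'e::finite pmf \<Rightarrow> real ^ 'e \<Rightarrow> real ^ 'e" where
  "euclidean_embedding \<pi> g = (\<chi> x. sqrt (pmf \<pi> x) * g $ x)"

lemma inner_pi_eq_inner:
  "inner_pi \<pi> g h = euclidean_embedding \<pi> g \<bullet> euclidean_embedding \<pi> h"
proof -
  have "sqrt (pmf \<pi> x) * g $ x * (sqrt (pmf \<pi> x) * h $ x) = g $ x * h $ x * pmf \<pi> x" for x
  proof -
    have "sqrt (pmf \<pi> x) * g $ x * (sqrt (pmf \<pi> x) * h $ x)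
        = (sqrt (pmf \<pi> x) * sqrt (pmf \<pi> x)) * (g $ x * h $ x)"
      by (simp only: mult_ac)
    then show ?thesis by simp
  qed
  then show ?thesis
    by (simp only: inner_pi_def inner_vec_def euclidean_embedding_def vec_lambda_beta inner_real_def)
qed

lemma norm_pi_eq_norm: "norm_pi \<pi> g = norm (euclidean_embedding \<pi> g)"
  by (simp add: norm_pi_def inner_pi_eq_inner norm_eq_sqrt_inner)

lemma linear_euclidean_embedding: "linear (euclidean_embedding \<pi>)"
  by (rule linearI) (simp_all add: euclidean_embedding_def vec_eq_iff algebra_simps)

lemma inner_pi_bilinear [simp]:
  "inner_pi \<pi> (g + g') h = inner_pi \<pi> g h + inner_pi \<pi> g' h"
  "inner_pi \<pi> g (h + h') = inner_pi \<pi> g h + inner_pi \<pi> g h'"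
  "inner_pi \<pi> (g - g') h = inner_pi \<pi> g h - inner_pi \<pi> g' h"
  "inner_pi \<pi> g (h - h') = inner_pi \<pi> g h - inner_pi \<pi> g h'"
  "inner_pi \<pi> (c *\<^sub>R g) h = c * inner_pi \<pi> g h"
  "inner_pi \<pi> g (c *\<^sub>R h) = c * inner_pi \<pi> g h"
  "inner_pi \<pi> 0 h = 0" "inner_pi \<pi> g 0 = 0"
  "inner_pi \<pi> (- g) h = - inner_pi \<pi> g h"
  "inner_pi \<pi> g (- h) = - inner_pi \<pi> g h"
  using linear_euclidean_embedding[of \<pi>]
  by (simp_all add: inner_pi_eq_inner linear_add linear_diff linear_scale linear_0 linear_neg
      inner_simps)

lemma inner_pi_commute: "inner_pi \<pi> g h = inner_pi \<pi> h g"
  by (simp add: inner_pi_eq_inner inner_commute)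

lemma inner_pi_self_nonneg: "inner_pi \<pi> g g \<ge> 0"
  by (simp add: inner_pi_eq_inner)

lemma norm_pi_nonneg: "norm_pi \<pi> g \<ge> 0"
  by (simp add: norm_pi_eq_norm)

lemma norm_pi_sq: "(norm_pi \<pi> g)\<^sup>2 = inner_pi \<pi> g g"
  by (simp add: norm_pi_def inner_pi_self_nonneg)

lemma norm_pi_triangle: "norm_pi \<pi> (g + h) \<le> norm_pi \<pi> g + norm_pi \<pi> h"
  by (simp add: norm_pi_eq_norm linear_add[OF linear_euclidean_embedding] norm_triangle_ineq)

lemma inner_pi_Cauchy_Schwarz: "inner_pi \<pi> g h \<le> norm_pi \<pi> g * norm_pi \<pi> h"
  by (simp add: inner_pi_eq_inner norm_pi_eq_norm norm_cauchy_schwarz)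

lemma mean_eq_inner_pi: "mean \<pi> g = inner_pi \<pi> (vec 1) g"
  by (simp add: mean_def inner_pi_def integral_measure_pmf[of UNIV] mult.commute)

lemma inner_pi_vec: "inner_pi \<pi> (vec c) g = c * mean \<pi> g"
  by (simp add: mean_eq_inner_pi inner_pi_def sum_distrib_left mult.assoc)

lemma sum_pmf_UNIV: "(\<Sum>x\<in>UNIV. pmf \<pi> x) = 1" for \<pi> :: "'e::finite pmf"
  by (rule sum_pmf_eq_1) auto

lemma mean_vec: "mean \<pi> (vec c) = c"
  by (simp add: mean_eq_inner_pi inner_pi_def sum_pmf_UNIV flip: sum_distrib_left)

lemma norm_pi_vec_1: "norm_pi \<pi> (vec 1) = 1"
  using mean_vec[of \<pi> 1] by (simp add: norm_pi_def mean_eq_inner_pi)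

text \<open>Irreducibility enters the spectral theory only through its two consequences
  that \<open>\<pi>\<close> charges every state and that harmonic functions are constant.\<close>

locale ergodic_generator =
  fixes Q :: "real ^ 'e ^ 'e" and \<pi> :: "'e::finite pmf"
  assumes two_states: "CARD('e) \<ge> 2"
    and off_diagonal: "x \<noteq> y \<Longrightarrow> Q $ x $ y \<ge> 0"
    and row_sum: "(\<Sum>y\<in>UNIV. Q $ x $ y) = 0"
    and invariant: "invariant_distribution Q \<pi>"
    and pi_pos: "pmf \<pi> x > 0"
    and harmonic_constant: "Q *v g = 0 \<Longrightarrow> \<exists>c. g = vec c"
begin

abbreviation K where "K \<equiv> symmetric_part \<pi> ((*v) Q)"

lemma inner_pi_self_eq_0: "inner_pi \<pi> g g = 0 \<longleftrightarrow> g = 0"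
proof
  assume "inner_pi \<pi> g g = 0"
  then have "euclidean_embedding \<pi> g = 0" by (simp add: inner_pi_eq_inner)
  then have "sqrt (pmf \<pi> x) * g $ x = 0" for x
    by (simp add: euclidean_embedding_def vec_eq_iff)
  then show "g = 0" using pi_pos by (simp add: vec_eq_iff less_imp_neq[symmetric])
qed simp

text \<open>Since \<open>\<pi>\<close> has full support, \<^const>\<open>inner_pi\<close> is nondegenerate, and the choice in
  \<^const>\<open>adjoint_pi\<close> is unique: it is the matrix of the time-reversed process.\<close>

definition reversed :: "real ^ 'e ^ 'e" where
  "reversed = (\<chi> x y. pmf \<pi> y * Q $ y $ x / pmf \<pi> x)"

lemma reversed_adjoint: "inner_pi \<pi> (Q *v g) h = inner_pi \<pi> g (reversed *v h)"
proof -
  have "inner_pi \<pi> (Q *v g) h = (\<Sum>x\<in>UNIV. \<Sum>y\<in>UNIV. pmf \<pi> x * Q $ x $ y * g $ y * h $ x)"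
    by (simp add: inner_pi_def matrix_vector_mult_def sum_distrib_right sum_distrib_left mult_ac)
  also have "\<dots> = (\<Sum>y\<in>UNIV. \<Sum>x\<in>UNIV. pmf \<pi> x * Q $ x $ y * g $ y * h $ x)"
    by (rule sum.swap)
  also have "\<dots> = inner_pi \<pi> g (reversed *v h)"
    using pi_pos
    by (simp add: inner_pi_def matrix_vector_mult_def reversed_def sum_distrib_right
        sum_distrib_left less_imp_neq[symmetric] mult_ac)
  finally show ?thesis .
qed

lemma adjoint_eq_reversed: "adjoint_pi \<pi> ((*v) Q) = (*v) reversed"
proof
  fix h
  have "\<forall>g h. inner_pi \<pi> (Q *v g) h = inner_pi \<pi> g (adjoint_pi \<pi> ((*v) Q) h)"
    unfolding adjoint_pi_def by (rule someI[of _ "(*v) reversed"]) (simp add: reversed_adjoint)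
  then have "inner_pi \<pi> g (adjoint_pi \<pi> ((*v) Q) h - reversed *v h) = 0" for g
    using reversed_adjoint by simp
  then show "adjoint_pi \<pi> ((*v) Q) h = reversed *v h"
    using inner_pi_self_eq_0 eq_iff_diff_eq_0 by blast
qed

lemma K_eq: "K g = (1 / 2) *\<^sub>R (Q *v g + reversed *v g)"
  by (simp add: symmetric_part_def adjoint_eq_reversed)

lemma linear_K: "linear K"
  by (rule linearI)
    (simp_all add: K_eq matrix_vector_right_distrib matrix_vector_mult_scaleR algebra_simps)

lemma K_self_adjoint: "inner_pi \<pi> (K g) h = inner_pi \<pi> g (K h)"
  using reversed_adjoint[of g h] reversed_adjoint[of h g]
  by (simp add: K_eq inner_pi_commute)

lemma K_form: "inner_pi \<pi> g (K g) = inner_pi \<pi> g (Q *v g)"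
  using reversed_adjoint[of g g] by (simp add: K_eq inner_pi_commute)

lemma dirichlet_form:
  "inner_pi \<pi> g (K g)
     = - (1 / 2) * (\<Sum>x\<in>UNIV. \<Sum>y\<in>UNIV. pmf \<pi> x * Q $ x $ y * (g $ x - g $ y)\<^sup>2)"
proof -
  have "(\<Sum>x\<in>UNIV. \<Sum>y\<in>UNIV. pmf \<pi> x * Q $ x $ y * (g $ x - g $ y)\<^sup>2)
      = (\<Sum>x\<in>UNIV. \<Sum>y\<in>UNIV. pmf \<pi> x * (g $ x)\<^sup>2 * Q $ x $ y)
        + (\<Sum>x\<in>UNIV. \<Sum>y\<in>UNIV. (g $ y)\<^sup>2 * (pmf \<pi> x * Q $ x $ y))
        - 2 * (\<Sum>x\<in>UNIV. \<Sum>y\<in>UNIV. pmf \<pi> x * Q $ x $ y * g $ x * g $ y)"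
    by (simp add: power2_diff algebra_simps sum.distrib sum_subtractf sum_distrib_left)
  also have "(\<Sum>x\<in>UNIV. \<Sum>y\<in>UNIV. pmf \<pi> x * (g $ x)\<^sup>2 * Q $ x $ y) = 0"
    by (simp add: row_sum flip: sum_distrib_left)
  also have "(\<Sum>x\<in>UNIV. \<Sum>y\<in>UNIV. (g $ y)\<^sup>2 * (pmf \<pi> x * Q $ x $ y)) = 0"
    using invariant
    by (subst sum.swap) (simp add: invariant_distribution_def flip: sum_distrib_left)
  also have "(\<Sum>x\<in>UNIV. \<Sum>y\<in>UNIV. pmf \<pi> x * Q $ x $ y * g $ x * g $ y) = inner_pi \<pi> g (Q *v g)"
    by (simp add: inner_pi_def matrix_vector_mult_def sum_distrib_right sum_distrib_left mult_ac)
  finally show ?thesis by (simp add: K_form)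
qed

lemma dirichlet_summand_nonneg: "pmf \<pi> x * Q $ x $ y * (g $ x - g $ y)\<^sup>2 \<ge> 0"
  using off_diagonal[of x y] by (cases "x = y") auto

lemma K_nonpos: "inner_pi \<pi> g (K g) \<le> 0"
  unfolding dirichlet_form using dirichlet_summand_nonneg by (simp add: sum_nonneg)

text \<open>If the Dirichlet form vanishes at \<open>g\<close>, then \<open>g\<close> is constant along every possible jump, so
  that \<open>g\<close> is harmonic for \<open>Q\<close> itself, and not only for its symmetric part.\<close>

lemma K_form_eq_0:
  assumes "inner_pi \<pi> g (K g) = 0" shows "\<exists>c. g = vec c"
proof -
  have "(\<Sum>x\<in>UNIV. \<Sum>y\<in>UNIV. pmf \<pi> x * Q $ x $ y * (g $ x - g $ y)\<^sup>2) = 0"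
    using assms by (simp add: dirichlet_form)
  then have "(\<Sum>y\<in>UNIV. pmf \<pi> x * Q $ x $ y * (g $ x - g $ y)\<^sup>2) = 0" for x
    by (subst (asm) sum_nonneg_eq_0_iff) (auto intro!: sum_nonneg dirichlet_summand_nonneg)
  then have "pmf \<pi> x * Q $ x $ y * (g $ x - g $ y)\<^sup>2 = 0" for x y
    by (subst (asm) sum_nonneg_eq_0_iff) (auto intro!: dirichlet_summand_nonneg)
  then have jump: "Q $ x $ y * g $ y = Q $ x $ y * g $ x" for x y
    using pi_pos[of x] by (metis eq_iff_diff_eq_0 less_irrefl mult_eq_0_iff power_eq_0_iff)
  have "(\<Sum>y\<in>UNIV. Q $ x $ y * g $ y) = (\<Sum>y\<in>UNIV. Q $ x $ y * g $ x)" for x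
    by (rule sum.cong[OF refl jump])
  then have "(\<Sum>y\<in>UNIV. Q $ x $ y * g $ y) = 0" for x
    by (simp add: row_sum flip: sum_distrib_right)
  then have "Q *v g = 0" by (simp add: matrix_vector_mult_def vec_eq_iff)
  then show ?thesis by (rule harmonic_constant)
qed

lemma K_form_eq_0_centered:
  assumes "inner_pi \<pi> g (K g) = 0" "mean \<pi> g = 0" shows "g = 0"
proof -
  obtain c where "g = vec c" using K_form_eq_0[OF assms(1)] by blast
  with assms(2) show ?thesis by (simp add: mean_vec vec_eq_iff)
qed

lemma K_vec: "K (vec c) = 0"
proof -
  have "reversed *v vec c = vec c v* (\<chi> x y. pmf \<pi> x * Q $ x $ y / pmf \<pi> y)"
    by (simp add: matrix_vector_mult_def vector_matrix_mult_def reversed_def mult_ac)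
  also have "\<dots> = 0"
    using invariant
    by (simp add: vector_matrix_mult_def vec_eq_iff invariant_distribution_def
        flip: sum_distrib_left sum_divide_distrib)
  finally have "reversed *v vec c = 0" .
  moreover have "Q *v vec c = 0"
    by (simp add: matrix_vector_mult_def vec_eq_iff row_sum flip: sum_distrib_right)
  ultimately show ?thesis by (simp add: K_eq)
qed

lemma mean_K: "mean \<pi> (K g) = 0"
  using K_vec[of 1] by (simp add: mean_eq_inner_pi flip: K_self_adjoint)


section \<open>Spectral gap and reduced resolvent\<close>

lemma spectrum_K: "s \<in> spectrum K \<longleftrightarrow> (\<exists>g. g \<noteq> 0 \<and> K g = s *\<^sub>R g)"
proof -
  have lin: "linear (\<lambda>g. K g - s *\<^sub>R g)"
    by (intro linear_compose_sub linear_K linear_scaleR)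
  have "bij (\<lambda>g. K g - s *\<^sub>R g) \<longleftrightarrow> inj (\<lambda>g. K g - s *\<^sub>R g)"
    using linear_injective_imp_surjective[OF lin] unfolding bij_def by blast
  also have "\<dots> \<longleftrightarrow> (\<forall>g. K g - s *\<^sub>R g = 0 \<longrightarrow> g = 0)"
    by (rule linear_injective_0[OF lin])
  finally show ?thesis by (auto simp: spectrum_def)
qed

text \<open>Eigenvectors of a self-adjoint operator to different eigenvalues are orthogonal, so there are
  at most as many eigenvalues as dimensions.\<close>

lemma finite_spectrum_K: "finite (spectrum K)"
proof -
  obtain e where e: "\<And>s. s \<in> spectrum K \<Longrightarrow> e s \<noteq> 0 \<and> K (e s) = s *\<^sub>R e s"
    using spectrum_K[THEN iffD1] by metis
  let ?u = "\<lambda>s. euclidean_embedding \<pi> (e s)"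
  have orth: "?u s \<bullet> ?u s' = 0" if "s \<in> spectrum K" "s' \<in> spectrum K" "s \<noteq> s'" for s s'
  proof -
    have "s * inner_pi \<pi> (e s) (e s') = s' * inner_pi \<pi> (e s) (e s')"
      using K_self_adjoint[of "e s" "e s'"] e[OF that(1)] e[OF that(2)] by simp
    with that(3) show ?thesis by (simp add: inner_pi_eq_inner)
  qed
  have nz: "?u s \<noteq> 0" if "s \<in> spectrum K" for s
    using e[OF that] inner_pi_self_eq_0[of "e s"] by (auto simp: inner_pi_eq_inner)
  have "inj_on ?u (spectrum K)"
  proof (rule inj_onI, rule ccontr)
    fix s s' assume *: "s \<in> spectrum K" "s' \<in> spectrum K" "?u s = ?u s'" "s \<noteq> s'"
    with orth[of s s'] nz[of s'] show False by simp
  qed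
  moreover have "independent (?u ` spectrum K)"
    using orth nz by (intro pairwise_orthogonal_independent)
      (auto simp: pairwise_def orthogonal_def)
  ultimately show ?thesis
    using independent_imp_finite finite_imageD by blast
qed

lemma linear_mean: "linear (mean \<pi>)"
  by (rule linearI) (simp_all add: mean_eq_inner_pi)

lemma exists_centered_unit: "\<exists>g. mean \<pi> g = 0 \<and> inner_pi \<pi> g g = 1"
proof -
  obtain a b :: 'e where "a \<noteq> b"
    using two_states by (metis card_2_iff' ex_card top_greatest subset_iff UNIV_I)
  define h where "h = axis a (1::real) - vec (mean \<pi> (axis a 1))"
  have "h $ a \<noteq> h $ b" using \<open>a \<noteq> b\<close> by (simp add: h_def axis_def)
  then have "h \<noteq> 0" by auto
  then have pos: "inner_pi \<pi> h h > 0"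
    using inner_pi_self_eq_0[of h] inner_pi_self_nonneg[of \<pi> h] by linarith
  have "mean \<pi> h = 0"
    by (simp add: h_def linear_diff[OF linear_mean] mean_vec)
  then have "mean \<pi> ((1 / norm_pi \<pi> h) *\<^sub>R h) = 0"
    by (simp add: linear_scale[OF linear_mean])
  moreover have "inner_pi \<pi> ((1 / norm_pi \<pi> h) *\<^sub>R h) ((1 / norm_pi \<pi> h) *\<^sub>R h) = 1"
    using pos by (simp add: norm_pi_sq[symmetric] power2_eq_square) (auto simp: norm_pi_def)
  ultimately show ?thesis by blast
qed

lemma compact_centered_sphere: "compact {g. mean \<pi> g = 0 \<and> inner_pi \<pi> g g = 1}"
proof (rule compact_eq_bounded_closed[THEN iffD2], intro conjI)
  have c: "continuous_on UNIV (\<lambda>g. inner_pi \<pi> g g)"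
    unfolding inner_pi_def by (intro continuous_intros)
  have "closed ({g. mean \<pi> g = 0} \<inter> {g. inner_pi \<pi> g g = 1})"
    by (intro closed_Int closed_Collect_eq c continuous_on_const linear_continuous_on
        linear_conv_bounded_linear[THEN iffD1, OF linear_mean])
  then show "closed {g. mean \<pi> g = 0 \<and> inner_pi \<pi> g g = 1}" by (simp add: Collect_conj_eq)
next
  let ?U = "euclidean_embedding \<pi>"
  have "inj ?U"
    unfolding linear_injective_0[OF linear_euclidean_embedding]
    using inner_pi_self_eq_0 by (auto simp: inner_pi_eq_inner)
  then obtain B where B: "B > 0" "\<And>g. B * norm g \<le> norm (?U g)"
    using linear_inj_bounded_below_pos[OF linear_euclidean_embedding] by metis
  show "bounded {g. mean \<pi> g = 0 \<and> inner_pi \<pi> g g = 1}"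
  proof (rule boundedI)
    fix g assume "g \<in> {g. mean \<pi> g = 0 \<and> inner_pi \<pi> g g = 1}"
    then have "norm (?U g) = 1" by (simp add: inner_pi_eq_inner norm_eq_sqrt_inner)
    with B(2)[of g] B(1) show "norm g \<le> 1 / B" by (simp add: field_simps)
  qed
qed

text \<open>A minimiser of the Dirichlet form on the unit sphere of the complement of the constants is an
  eigenvector: the form minus its minimum is positive semidefinite there and vanishes at the
  minimiser, so that its polarisation pairs the minimiser to \<open>0\<close> with every centered vector, in
  particular with the residual \<open>w\<close> of the eigenvalue equation.\<close>

lemma smallest_nonzero_eigenvalue:
  obtains m where "m > 0" "- m \<in> spectrum K"
    "\<And>g. mean \<pi> g = 0 \<Longrightarrow> m * inner_pi \<pi> g g \<le> - inner_pi \<pi> g (K g)"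
proof -
  let ?S = "{g. mean \<pi> g = 0 \<and> inner_pi \<pi> g g = 1}"
  have "continuous_on ?S K"
    using linear_K linear_conv_bounded_linear linear_continuous_on by blast
  then have "continuous_on ?S (\<lambda>g. - inner_pi \<pi> g (K g))"
    unfolding inner_pi_def by (intro continuous_intros)
  then obtain g0 where g0: "mean \<pi> g0 = 0" "inner_pi \<pi> g0 g0 = 1"
    and min: "\<And>g. g \<in> ?S \<Longrightarrow> - inner_pi \<pi> g0 (K g0) \<le> - inner_pi \<pi> g (K g)"
    using continuous_attains_inf[OF compact_centered_sphere] exists_centered_unit by blast
  define m where "m = - inner_pi \<pi> g0 (K g0)"
  have g0_nz: "g0 \<noteq> 0" using g0(2) by auto
  have m_pos: "m > 0"
    using K_nonpos[of g0] K_form_eq_0_centered[of g0] g0(1) g0_nz unfolding m_def by force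
  have gap: "m * inner_pi \<pi> g g \<le> - inner_pi \<pi> g (K g)" if "mean \<pi> g = 0" for g
  proof (cases "g = 0")
    case False
    then have n: "norm_pi \<pi> g > 0"
      using inner_pi_self_eq_0[of g] norm_pi_nonneg[of \<pi> g] by (auto simp: norm_pi_def less_le)
    let ?c = "1 / norm_pi \<pi> g"
    have "?c * (?c * inner_pi \<pi> g g) = 1"
      using n unfolding norm_pi_sq[symmetric] by (simp add: power2_eq_square)
    then have "?c *\<^sub>R g \<in> ?S"
      using that False inner_pi_self_eq_0[of g] by (simp add: linear_scale[OF linear_mean])
    from min[OF this] have "m \<le> ?c * (?c * - inner_pi \<pi> g (K g))"
      unfolding m_def by (simp add: linear_scale[OF linear_K])
    then have "m * (norm_pi \<pi> g)\<^sup>2 \<le> - inner_pi \<pi> g (K g)"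
      using n by (simp add: field_simps power2_eq_square)
    then show ?thesis by (simp add: norm_pi_sq)
  qed simp
  define w where "w = - K g0 - m *\<^sub>R g0"
  have mean_w: "mean \<pi> w = 0"
    using g0(1) by (simp add: w_def mean_K linear_diff[OF linear_mean]
        linear_neg[OF linear_mean] linear_scale[OF linear_mean])
  define b where "b = inner_pi \<pi> w w"
  define a where "a = - inner_pi \<pi> w (K w) - m * b"
  have quad: "0 \<le> s\<^sup>2 * a + 2 * s * b" for s
  proof -
    have "m * inner_pi \<pi> (g0 + s *\<^sub>R w) (g0 + s *\<^sub>R w)
        \<le> - inner_pi \<pi> (g0 + s *\<^sub>R w) (K (g0 + s *\<^sub>R w))"
      by (rule gap) (simp add: g0(1) mean_w linear_add[OF linear_mean] linear_scale[OF linear_mean])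
    moreover have "inner_pi \<pi> g0 (K w) = inner_pi \<pi> w (K g0)"
      by (metis K_self_adjoint inner_pi_commute)
    moreover have "inner_pi \<pi> w (K g0) = - b - m * inner_pi \<pi> w g0"
    proof -
      have "K g0 = - w - m *\<^sub>R g0" by (simp add: w_def)
      then show ?thesis by (simp add: b_def)
    qed
    moreover have "inner_pi \<pi> g0 w = inner_pi \<pi> w g0" by (rule inner_pi_commute)
    ultimately show ?thesis
      by (simp add: linear_add[OF linear_K] linear_scale[OF linear_K] a_def b_def[symmetric]
          m_def[symmetric] g0(2) algebra_simps power2_eq_square)
        (simp add: m_def algebra_simps)
  qed
  \<comment> \<open>A quadratic without constant term that is nonnegative has no linear term.\<close>
  have "b = 0"
  proof (rule ccontr)
    assume "b \<noteq> 0"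
    then have "b > 0" using inner_pi_self_nonneg[of \<pi> w] by (simp add: b_def)
    define s where "s = - b / (\<bar>a\<bar> + 1)"
    have "s < 0" using \<open>b > 0\<close> by (simp add: s_def divide_less_0_iff add_nonneg_pos)
    have "s * (s * a + 2 * b) \<ge> 0"
      using quad[of s] by (simp add: power2_eq_square algebra_simps)
    then have "s * a + 2 * b \<le> 0"
      using \<open>s < 0\<close> by (simp add: zero_le_mult_iff)
    moreover have "\<bar>s * a\<bar> \<le> b"
      using \<open>b > 0\<close> by (simp add: s_def abs_mult field_simps)
    ultimately show False using \<open>b > 0\<close> by linarith
  qed
  then have "w = 0" using inner_pi_self_eq_0[of w] unfolding b_def by blast
  then have "- K g0 = m *\<^sub>R g0" by (simp add: w_def)
  then have "K g0 = (- m) *\<^sub>R g0" by (metis minus_minus scaleR_minus_left)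
  then have "- m \<in> spectrum K" using g0_nz spectrum_K by blast
  from m_pos this gap show thesis by (rule that)
qed

lemma spectral_gap_pos: "spectral_gap \<pi> Q > 0"
  and poincare: "mean \<pi> g = 0 \<Longrightarrow> spectral_gap \<pi> Q * inner_pi \<pi> g g \<le> - inner_pi \<pi> g (K g)"
proof -
  let ?A = "abs ` (spectrum K - {0})"
  obtain m where m: "m > 0" "- m \<in> spectrum K"
    "\<And>g. mean \<pi> g = 0 \<Longrightarrow> m * inner_pi \<pi> g g \<le> - inner_pi \<pi> g (K g)"
    by (rule smallest_nonzero_eigenvalue) blast
  have fin: "finite ?A" using finite_spectrum_K by simp
  have mem: "m \<in> ?A" using m(1,2) by (intro image_eqI[of _ _ "- m"]) auto
  have "Min ?A \<in> ?A" using fin mem by (intro Min_in) auto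
  then show "spectral_gap \<pi> Q > 0" by (auto simp: spectral_gap_def)
  have "spectral_gap \<pi> Q \<le> m" unfolding spectral_gap_def using fin mem by (rule Min_le)
  then show "spectral_gap \<pi> Q * inner_pi \<pi> g g \<le> - inner_pi \<pi> g (K g)" if "mean \<pi> g = 0"
    using m(3)[OF that] inner_pi_self_nonneg[of \<pi> g] by (meson mult_right_mono order_trans)
qed

text \<open>By the Dirichlet form, \<open>K\<close> is injective on the complement of the constants, which it maps into
  itself; hence it is onto there.\<close>

lemma reduced_resolvent_solves:
  assumes "mean \<pi> f = 0"
  shows "K (reduced_resolvent \<pi> K f) = f" and "mean \<pi> (reduced_resolvent \<pi> K f) = 0"
proof -
  let ?H = "{h. mean \<pi> h = 0}"
  have sub: "subspace ?H"
    using linear_subspace_kernel[OF linear_mean] by simp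
  have "inj_on K ?H"
  proof (rule inj_onI)
    fix g h assume *: "g \<in> ?H" "h \<in> ?H" "K g = K h"
    then have "K (g - h) = 0" "mean \<pi> (g - h) = 0"
      by (simp_all add: linear_diff[OF linear_K] linear_diff[OF linear_mean])
    then show "g = h" using K_form_eq_0_centered[of "g - h"] by simp
  qed
  then have "dim (K ` ?H) = dim ?H"
    using dim_image_eq[OF linear_K, of ?H] span_eq_iff[THEN iffD2, OF sub] by simp
  moreover have "K ` ?H \<subseteq> ?H" by (auto simp: mean_K)
  ultimately have onto: "K ` ?H = ?H"
    using subspace_dim_equal[of "K ` ?H" ?H] linear_subspace_image[OF linear_K sub] sub by simp
  have "f - (\<chi> x. mean \<pi> f) = f" by (simp add: assms vec_eq_iff)
  moreover have "f \<in> K ` ?H" using assms onto by simp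
  ultimately show "K (reduced_resolvent \<pi> K f) = f" "mean \<pi> (reduced_resolvent \<pi> K f) = 0"
    using f_inv_into_f[of f K ?H] inv_into_into[of f K ?H] by (simp_all add: reduced_resolvent_def)
qed

lemma sigma_hat_sq_eq:
  assumes "mean \<pi> f = 0"
  shows "sigma_hat_sq \<pi> Q f
    = - 2 * inner_pi \<pi> (reduced_resolvent \<pi> K f) (K (reduced_resolvent \<pi> K f))"
  by (simp add: sigma_hat_sq_def reduced_resolvent_solves[OF assms] inner_pi_commute)

lemma sigma_hat_sq_pos:
  assumes "mean \<pi> f = 0" "f \<noteq> 0" shows "sigma_hat_sq \<pi> Q f > 0"
proof -
  let ?w = "reduced_resolvent \<pi> K f"
  have "?w \<noteq> 0" using reduced_resolvent_solves(1)[OF assms(1)] assms(2) linear_0[OF linear_K] by auto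
  then have "inner_pi \<pi> ?w (K ?w) < 0"
    using K_form_eq_0_centered[of ?w] reduced_resolvent_solves(2)[OF assms(1)] K_nonpos[of ?w]
    by linarith
  then show ?thesis by (simp add: sigma_hat_sq_eq[OF assms(1)])
qed


section \<open>The quadratic form of the tilted generator\<close>

text \<open>Split \<open>g = a + h\<close> into its mean and a centered part. As \<open>f\<close> is centered, the form equals
  \<open>\<langle>h, K h\<rangle> + 2 r a \<langle>f, h\<rangle> + r \<langle>f h, h\<rangle>\<close>. The gap absorbs the last term into the first one, at the
  price of the factor \<open>\<kappa> = 1 - r F / l\<close>; then completing the square in \<open>h\<close>, with \<open>f = K (S f)\<close>,
  leaves \<open>r\<^sup>2 a\<^sup>2 (\<sigma>\<^sup>2 / 2) / \<kappa>\<close>. This is at most \<open>G(r) a\<^sup>2\<close>, because the denominator \<open>1 - 2 r F / l\<close>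
  of \<^const>\<open>G_fun\<close> is at most \<open>\<kappa>\<close>.\<close>

lemma tilted_form_le:
  assumes f: "mean \<pi> f = 0" and r: "0 \<le> r" "2 * (infnorm f / spectral_gap \<pi> Q) * r < 1"
  shows "inner_pi \<pi> g (Q *v g) + r * inner_pi \<pi> g (\<chi> x. f $ x * g $ x)
    \<le> G_fun (spectral_gap \<pi> Q) (infnorm f) (sigma_hat_sq \<pi> Q f) r * inner_pi \<pi> g g"
proof -
  define l where "l = spectral_gap \<pi> Q"
  define F where "F = infnorm f"
  define v where "v = sigma_hat_sq \<pi> Q f"
  define w where "w = reduced_resolvent \<pi> K f"
  define a where "a = mean \<pi> g"
  define h where "h = g - vec a"
  define D where "D = - inner_pi \<pi> h (K h)"
  define X where "X = inner_pi \<pi> f h"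
  define \<kappa> where "\<kappa> = 1 - r * F / l"
  have l: "l > 0" using spectral_gap_pos by (simp add: l_def)
  have F: "F \<ge> 0" by (simp add: F_def infnorm_pos_le)
  have rF: "0 \<le> r * F / l" using r(1) F l by simp
  have \<kappa>: "\<kappa> > 0" "1 - 2 * (F / l) * r \<le> \<kappa>" "1 - 2 * (F / l) * r > 0"
  proof -
    have "2 * (F / l) * r = 2 * (1 - \<kappa>)" by (simp add: \<kappa>_def mult.commute)
    moreover have "2 * (F / l) * r < 1" using r(2) by (simp only: F_def l_def)
    moreover have "\<kappa> \<le> 1" using rF by (simp add: \<kappa>_def)
    ultimately show "\<kappa> > 0" "1 - 2 * (F / l) * r \<le> \<kappa>" "1 - 2 * (F / l) * r > 0"
      by auto
  qed
  have Kw: "K w = f" using reduced_resolvent_solves(1)[OF f] by (simp add: w_def)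
  have W: "- inner_pi \<pi> w (K w) = v / 2" by (simp add: v_def w_def sigma_hat_sq_eq[OF f])
  have v: "v \<ge> 0" using W K_nonpos[of w] by linarith
  have g: "g = vec a + h" by (simp add: h_def)
  have mean_h: "mean \<pi> h = 0" by (simp add: h_def a_def linear_diff[OF linear_mean] mean_vec)
  have gg: "inner_pi \<pi> g g = a\<^sup>2 + inner_pi \<pi> h h"
    by (simp add: g inner_pi_vec mean_vec mean_h inner_pi_commute[of _ h "vec a"] power2_eq_square)
  have gKg: "inner_pi \<pi> g (Q *v g) = - D"
    unfolding K_form[symmetric] D_def g
    by (simp add: linear_add[OF linear_K] K_vec inner_pi_vec mean_K)
  have "inner_pi \<pi> g (\<chi> x. f $ x * g $ x)
      = a\<^sup>2 * mean \<pi> f + 2 * a * X + inner_pi \<pi> h (\<chi> x. f $ x * h $ x)"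
    unfolding g X_def mean_eq_inner_pi inner_pi_def sum_distrib_left sum.distrib[symmetric]
    by (rule sum.cong) (simp_all add: algebra_simps power2_eq_square)
  then have gfg: "inner_pi \<pi> g (\<chi> x. f $ x * g $ x) = 2 * a * X + inner_pi \<pi> h (\<chi> x. f $ x * h $ x)"
    by (simp add: f)
  have "inner_pi \<pi> h (\<chi> x. f $ x * h $ x) \<le> F * inner_pi \<pi> h h"
    unfolding inner_pi_def sum_distrib_left
  proof (rule sum_mono)
    fix x
    have "f $ x \<le> F" using component_le_infnorm_cart[of f x] by (simp add: F_def)
    then have "f $ x * ((h $ x)\<^sup>2 * pmf \<pi> x) \<le> F * ((h $ x)\<^sup>2 * pmf \<pi> x)"
      by (intro mult_right_mono) auto
    then show "h $ x * (\<chi> x. f $ x * h $ x) $ x * pmf \<pi> x \<le> F * (h $ x * h $ x * pmf \<pi> x)"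
      by (simp add: power2_eq_square mult_ac)
  qed
  also have "\<dots> \<le> F * (D / l)"
  proof (rule mult_left_mono[OF _ F])
    show "inner_pi \<pi> h h \<le> D / l"
      using poincare[OF mean_h] l by (simp add: D_def l_def field_simps)
  qed
  finally have hfh: "r * inner_pi \<pi> h (\<chi> x. f $ x * h $ x) \<le> r * (F * (D / l))"
    by (rule mult_left_mono[OF _ r(1)])
  \<comment> \<open>The square is the Dirichlet form of \<open>\<kappa> h + r a S f\<close>.\<close>
  have "inner_pi \<pi> (\<kappa> *\<^sub>R h + (r * a) *\<^sub>R w) (K (\<kappa> *\<^sub>R h + (r * a) *\<^sub>R w)) \<le> 0"
    by (rule K_nonpos)
  moreover have "inner_pi \<pi> w (K h) = X" "inner_pi \<pi> h (K w) = X"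
    using K_self_adjoint[of w h] by (simp_all add: Kw X_def inner_pi_commute)
  ultimately have sq: "0 \<le> \<kappa> * (\<kappa> * D - 2 * r * a * X) + r\<^sup>2 * a\<^sup>2 * (v / 2)"
    by (simp add: linear_add[OF linear_K] linear_scale[OF linear_K] D_def flip: W)
      (simp add: algebra_simps power2_eq_square)
  have "- D + r * (2 * a * X) + r * (F * (D / l)) = - (\<kappa> * D - 2 * r * a * X)"
    by (simp add: \<kappa>_def algebra_simps)
  also have "\<dots> \<le> (r\<^sup>2 * a\<^sup>2 * (v / 2)) / \<kappa>"
    unfolding pos_le_divide_eq[OF \<kappa>(1)] using sq by (simp add: algebra_simps)
  also have "\<dots> \<le> (r\<^sup>2 * a\<^sup>2 * (v / 2)) / (1 - 2 * (F / l) * r)"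
    using \<kappa> v by (intro divide_left_mono mult_pos_pos) auto
  also have "\<dots> = G_fun l F v r * a\<^sup>2" by (simp add: G_fun_def)
  also have "\<dots> \<le> G_fun l F v r * inner_pi \<pi> g g"
    using \<kappa>(3) v inner_pi_self_nonneg[of \<pi> h]
    by (intro mult_left_mono) (auto simp: G_fun_def gg)
  finally show ?thesis
    using hfh unfolding gKg gfg l_def F_def v_def by (simp add: algebra_simps)
qed

end


section \<open>The matrix exponential near the identity\<close>

text \<open>This dominates the exponential series entrywise by a scalar one. The sum of the moduli of all entries is a
  crude ratio, but the size of the constant in the error term of the expansion below is irrelevant in the
  limit of small steps.\<close>

lemma matrix_power_entry_le:
  fixes A :: "real ^ 'e ^ 'e::finite"
  defines "b \<equiv> \<Sum>x\<in>UNIV. \<Sum>y\<in>UNIV. \<bar>A $ x $ y\<bar>"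
  shows "\<bar>((**) A ^^ n) (mat 1) $ x $ y\<bar> \<le> b ^ n"
proof (induction n arbitrary: x y)
  case 0
  then show ?case by (simp add: mat_def)
next
  case (Suc n)
  let ?B = "((**) A ^^ n) (mat 1)"
  have "\<bar>((**) A ^^ Suc n) (mat 1) $ x $ y\<bar> \<le> (\<Sum>z\<in>UNIV. \<bar>A $ x $ z\<bar> * \<bar>?B $ z $ y\<bar>)"
    by (simp add: matrix_matrix_mult_def flip: abs_mult)
  also have "\<dots> \<le> (\<Sum>z\<in>UNIV. \<bar>A $ x $ z\<bar> * b ^ n)"
    by (intro sum_mono mult_left_mono Suc.IH) auto
  also have "\<dots> = (\<Sum>z\<in>UNIV. \<bar>A $ x $ z\<bar>) * b ^ n" by (simp add: sum_distrib_right)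
  also have "\<dots> \<le> b * b ^ n"
    unfolding b_def
    by (intro mult_right_mono member_le_sum[where f = "\<lambda>x. \<Sum>z\<in>UNIV. \<bar>A $ x $ z\<bar>"] zero_le_power sum_nonneg)
      (auto intro: sum_nonneg)
  finally show ?case by simp
qed

lemma matrix_exp_entry_sums:
  fixes A :: "real ^ 'e ^ 'e::finite"
  shows "(\<lambda>n. ((**) A ^^ n) (mat 1) $ x $ y / fact n) sums (matrix_exp A $ x $ y)"
proof -
  define b where "b = (\<Sum>x\<in>UNIV. \<Sum>y\<in>UNIV. \<bar>A $ x $ y\<bar>)"
  let ?a = "\<lambda>n. (1 / fact n) *\<^sub>R ((**) A ^^ n) (mat 1)"
  have "summable (\<lambda>n. ?a n $ x $ y)" for x y
  proof (rule summable_comparison_test'[OF summable_exp[of b]])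
    fix n
    show "norm (?a n $ x $ y) \<le> inverse (fact n) * b ^ n"
      using matrix_power_entry_le[where A = A and n = n and x = x and y = y] by (simp add: b_def field_simps)
  qed
  then have "(\<lambda>n. ?a n $ x $ y) sums (\<Sum>n. ?a n $ x $ y)" for x y
    by (rule summable_sums)
  then have "?a sums (\<chi> x y. \<Sum>n. ?a n $ x $ y)"
    unfolding sums_def by (intro vec_tendstoI) (simp add: sum_component)
  then have "?a sums matrix_exp A" unfolding matrix_exp_def by (rule sums_summable[THEN summable_sums])
  then have "(\<lambda>n. ?a n $ x $ y) sums (matrix_exp A $ x $ y)"
    unfolding sums_def sum_component[symmetric] by (intro tendsto_vec_nth)
  then show ?thesis by simp
qed

lemma matrix_exp_fixes_kernel:
  fixes A :: "real ^ 'e ^ 'e::finite"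
  assumes "A *v g = 0" shows "matrix_exp A *v g = g"
proof -
  have zero: "((**) A ^^ n) (mat 1) *v g = (if n = 0 then g else 0)" for n
    by (induction n) (auto simp: assms simp flip: matrix_vector_mul_assoc)
  have "(\<lambda>n. \<Sum>y\<in>UNIV. ((**) A ^^ n) (mat 1) $ x $ y / fact n * g $ y)
      sums (\<Sum>y\<in>UNIV. matrix_exp A $ x $ y * g $ y)" for x
    by (intro sums_sum sums_mult2 matrix_exp_entry_sums)
  moreover have "(\<Sum>y\<in>UNIV. ((**) A ^^ n) (mat 1) $ x $ y / fact n * g $ y)
      = (if n = 0 then g $ x else 0)" for n x
    using zero[of n]
    by (auto simp: matrix_vector_mult_def vec_eq_iff split: if_splits simp flip: sum_divide_distrib)
  ultimately have "(\<Sum>y\<in>UNIV. matrix_exp A $ x $ y * g $ y) = g $ x" for x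
    using sums_single[of 0 "\<lambda>_. g $ x"] sums_unique2 by fastforce
  then show ?thesis by (simp add: matrix_vector_mult_def vec_eq_iff)
qed

lemma matrix_exp_fixes_left_kernel:
  fixes A :: "real ^ 'e ^ 'e::finite"
  assumes "p v* A = 0" shows "p v* matrix_exp A = p"
proof -
  have zero: "p v* ((**) A ^^ n) (mat 1) = (if n = 0 then p else 0)" for n
    by (cases n) (auto simp: assms simp flip: vector_matrix_mul_assoc)
  have "(\<lambda>n. \<Sum>x\<in>UNIV. p $ x * (((**) A ^^ n) (mat 1) $ x $ y / fact n))
      sums (\<Sum>x\<in>UNIV. p $ x * matrix_exp A $ x $ y)" for y
    by (intro sums_sum sums_mult matrix_exp_entry_sums)
  moreover have "(\<Sum>x\<in>UNIV. p $ x * (((**) A ^^ n) (mat 1) $ x $ y / fact n))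
      = (if n = 0 then p $ y else 0)" for n y
    using zero[of n]
    by (auto simp: vector_matrix_mult_def vec_eq_iff split: if_splits simp flip: sum_divide_distrib)
  ultimately have "(\<Sum>x\<in>UNIV. p $ x * matrix_exp A $ x $ y) = p $ y" for y
    using sums_single[of 0 "\<lambda>_. p $ y"] sums_unique2 by fastforce
  then show ?thesis by (simp add: vector_matrix_mult_def vec_eq_iff)
qed

text \<open>A harmonic function is a fixed vector of the positive matrix \<open>exp Q\<close> and \<open>\<pi>\<close> is a left fixed
  vector. The maximum principle for \<open>exp Q\<close> makes the former constant, and positivity spreads the
  mass of the latter over all states.\<close>

lemma ergodic_generator_if_positive:
  fixes Q :: "real ^ 'e ^ 'e" and \<pi> :: "'e::finite pmf"
  assumes two: "CARD('e) \<ge> 2" and off: "\<And>x y. x \<noteq> y \<Longrightarrow> Q $ x $ y \<ge> 0"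
    and row: "\<And>x. (\<Sum>y\<in>UNIV. Q $ x $ y) = 0" and inv: "invariant_distribution Q \<pi>"
    and pos: "\<And>x y. matrix_exp Q $ x $ y > 0"
  shows "ergodic_generator Q \<pi>"
proof
  let ?P = "matrix_exp Q"
  show "pmf \<pi> y > 0" for y
  proof -
    have "(\<chi> x. pmf \<pi> x) v* Q = 0"
      using inv by (simp add: vector_matrix_mult_def vec_eq_iff invariant_distribution_def)
    from matrix_exp_fixes_left_kernel[OF this] have "pmf \<pi> y = (\<Sum>x\<in>UNIV. pmf \<pi> x * ?P $ x $ y)"
      by (simp add: vector_matrix_mult_def vec_eq_iff)
    moreover obtain x where "pmf \<pi> x > 0"
      using set_pmf_not_empty[of \<pi>] pmf_positive[of _ \<pi>] by blast
    ultimately show ?thesis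
      using pos by (auto intro!: sum_pos2[of _ x] simp: less_imp_le)
  qed
  show "\<exists>c. g = vec c" if "Q *v g = 0" for g
  proof -
    obtain x where x: "\<And>y. g $ y \<le> g $ x"
      using finite_imageI[OF finite[of UNIV], of "($) g"] Max_in[of "range (($) g)"]
        Max_ge[of "range (($) g)"] by (metis UNIV_not_empty image_is_empty rangeE rangeI)
    have "Q *v 1 = 0" using row by (simp add: matrix_vector_mult_def vec_eq_iff)
    from matrix_exp_fixes_kernel[OF this] have "(\<Sum>y\<in>UNIV. ?P $ x $ y) = 1"
      by (simp add: matrix_vector_mult_def vec_eq_iff)
    moreover have "(\<Sum>y\<in>UNIV. ?P $ x $ y * g $ y) = g $ x"
      using matrix_exp_fixes_kernel[OF that] by (simp add: matrix_vector_mult_def vec_eq_iff)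
    ultimately have "(\<Sum>y\<in>UNIV. ?P $ x $ y * (g $ x - g $ y)) = 0"
      by (simp add: right_diff_distrib sum_subtractf flip: sum_distrib_right)
    then have "?P $ x $ y * (g $ x - g $ y) = 0" for y
      by (subst (asm) sum_nonneg_eq_0_iff) (auto simp: x pos less_imp_le)
    then have "g $ y = g $ x" for y using pos[of x y] by (metis eq_iff_diff_eq_0 less_irrefl mult_eq_0_iff)
    then have "g = vec (g $ x)" by (simp add: vec_eq_iff)
    then show ?thesis by blast
  qed
qed (use assms in auto)

lemma matrix_power_scaleR:
  fixes A :: "real ^ 'e ^ 'e::finite"
  shows "((**) (h *\<^sub>R A) ^^ n) (mat 1) = h ^ n *\<^sub>R ((**) A ^^ n) (mat 1)"
  by (induction n) (simp_all add: matrix_matrix_mult_def vec_eq_iff sum_distrib_left mult_ac)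

lemma matrix_exp_second_order:
  fixes A :: "real ^ 'e ^ 'e::finite"
  obtains C where "C \<ge> 0"
    "\<And>h x y. \<lbrakk>0 \<le> h; h \<le> t\<rbrakk> \<Longrightarrow>
      \<bar>matrix_exp (h *\<^sub>R A) $ x $ y - mat 1 $ x $ y - h * A $ x $ y\<bar> \<le> C * h\<^sup>2"
proof -
  define b where "b = (\<Sum>x\<in>UNIV. \<Sum>y\<in>UNIV. \<bar>A $ x $ y\<bar>)"
  have b: "b \<ge> 0" by (auto simp: b_def intro!: sum_nonneg)
  define c where "c n = b ^ (n + 2) * t ^ n / fact (n + 2)" for n
  have sum_c: "summable c" if "t \<ge> 0"
  proof (rule summable_comparison_test'[OF summable_mult[OF summable_exp[of "b * t"], of "b\<^sup>2"]])
    fix n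
    have "c n = b\<^sup>2 * (b * t) ^ n / fact (n + 2)"
      by (simp add: c_def power_add power_mult_distrib power2_eq_square mult_ac)
    also have "\<dots> \<le> b\<^sup>2 * (b * t) ^ n / fact n"
      using b that by (intro divide_left_mono fact_mono mult_nonneg_nonneg zero_le_power) auto
    finally show "norm (c n) \<le> b\<^sup>2 * (inverse (fact n) * (b * t) ^ n)"
      using b that by (simp add: c_def field_simps power2_eq_square)
  qed
  show thesis
  proof (rule that[of "max 0 (suminf c)"])
    fix h :: real and x y assume h: "0 \<le> h" "h \<le> t"
    let ?a = "\<lambda>n. h ^ n * ((**) A ^^ n) (mat 1) $ x $ y / fact n"
    have "?a sums (matrix_exp (h *\<^sub>R A) $ x $ y)"
      using matrix_exp_entry_sums[of "h *\<^sub>R A" x y] by (simp add: matrix_power_scaleR)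
    then have tail: "(\<lambda>n. ?a (n + 2)) sums (matrix_exp (h *\<^sub>R A) $ x $ y - (\<Sum>i<2. ?a i))"
      by (rule sums_split_initial_segment)
    have le: "norm (?a (n + 2)) \<le> h\<^sup>2 * c n" for n
    proof -
      have "\<bar>((**) A ^^ (n + 2)) (mat 1) $ x $ y\<bar> \<le> b ^ (n + 2)"
        using matrix_power_entry_le[where A = A and n = "n + 2" and x = x and y = y] by (simp only: b_def)
      moreover have "h ^ (n + 2) \<le> h\<^sup>2 * t ^ n"
        unfolding power_add using h by (subst mult.commute) (intro mult_left_mono power_mono; simp)
      ultimately have "h ^ (n + 2) * \<bar>((**) A ^^ (n + 2)) (mat 1) $ x $ y\<bar> \<le> (h\<^sup>2 * t ^ n) * b ^ (n + 2)"
        using h by (intro mult_mono) auto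
      then have "h ^ (n + 2) * \<bar>((**) A ^^ (n + 2)) (mat 1) $ x $ y\<bar> / fact (n + 2)
          \<le> (h\<^sup>2 * t ^ n) * b ^ (n + 2) / fact (n + 2)"
        by (rule divide_right_mono) simp
      moreover have "norm (?a (n + 2)) = h ^ (n + 2) * \<bar>((**) A ^^ (n + 2)) (mat 1) $ x $ y\<bar> / fact (n + 2)"
        using h(1) by (simp only: real_norm_def abs_divide abs_mult power_abs abs_of_nonneg fact_ge_zero)
      ultimately show ?thesis unfolding c_def by (simp only: times_divide_eq_right mult_ac)
    qed
    have "summable c" using sum_c h by auto
    then have "norm (\<Sum>n. ?a (n + 2)) \<le> (\<Sum>n. h\<^sup>2 * c n)"
      by (intro norm_suminf_le le summable_mult)
    also have "\<dots> = h\<^sup>2 * suminf c" by (rule suminf_mult) fact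
    also have "\<dots> \<le> max 0 (suminf c) * h\<^sup>2" by (simp add: mult.commute mult_right_mono)
    finally show "\<bar>matrix_exp (h *\<^sub>R A) $ x $ y - mat 1 $ x $ y - h * A $ x $ y\<bar> \<le> max 0 (suminf c) * h\<^sup>2"
      using sums_unique[OF tail] by (simp add: numeral_2_eq_2 diff_diff_eq)
  qed simp
qed


section \<open>One step of the tilted chain\<close>

lemma exp_first_order_error: "\<bar>exp z - 1\<bar> \<le> \<bar>z\<bar> * exp \<bar>z\<bar>" for z :: real
proof -
  obtain s where s: "\<bar>s\<bar> \<le> \<bar>z\<bar>" "exp z = (\<Sum>m<1. z ^ m / fact m) + exp s / fact 1 * z ^ 1"
    using Maclaurin_exp_le[of z 1] by blast
  have "\<bar>exp z - 1\<bar> = \<bar>z\<bar> * exp s" using s(2) by (simp add: abs_mult)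
  also have "\<dots> \<le> \<bar>z\<bar> * exp \<bar>z\<bar>" using s(1) by (intro mult_left_mono) auto
  finally show ?thesis .
qed

lemma exp_second_order_error: "\<bar>exp z - 1 - z\<bar> \<le> z\<^sup>2 * exp \<bar>z\<bar>" for z :: real
proof -
  obtain s where s: "\<bar>s\<bar> \<le> \<bar>z\<bar>" "exp z = (\<Sum>m<2. z ^ m / fact m) + exp s / fact 2 * z ^ 2"
    using Maclaurin_exp_le[of z 2] by blast
  have "\<bar>exp z - 1 - z\<bar> = z\<^sup>2 * exp s / 2" using s(2) by (simp add: numeral_2_eq_2 abs_mult)
  also have "\<dots> \<le> z\<^sup>2 * exp s" by simp
  also have "\<dots> \<le> z\<^sup>2 * exp \<bar>z\<bar>" using s(1) by (intro mult_left_mono) auto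
  finally show ?thesis .
qed

lemma norm_pi_le:
  assumes "\<And>x. \<bar>g $ x\<bar> \<le> m" shows "norm_pi \<pi> g \<le> m"
proof -
  have m: "m \<ge> 0" using assms[of undefined] by linarith
  have "inner_pi \<pi> g g \<le> (\<Sum>x\<in>UNIV. m\<^sup>2 * pmf \<pi> x)"
    unfolding inner_pi_def power2_eq_square[symmetric]
    by (intro sum_mono mult_right_mono) (use assms m in \<open>auto simp flip: abs_le_square_iff\<close>)
  also have "\<dots> = m\<^sup>2" by (simp add: sum_pmf_UNIV flip: sum_distrib_left)
  finally show ?thesis unfolding norm_pi_def using m by (simp add: real_sqrt_le_iff' real_le_lsqrt)
qed

text \<open>The iterates of this matrix, applied to the constant \<open>1\<close>, are the exponential moments of Riemann
  sums of the additive functional of \<open>f\<close>; a parameter \<open>r\<close> is absorbed into \<open>f\<close>.\<close>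

definition tilted_step :: "real ^ 'e ^ 'e \<Rightarrow> real ^ 'e \<Rightarrow> real \<Rightarrow> real ^ 'e ^ 'e::finite" where
  "tilted_step Q f h = (\<chi> x y. matrix_exp (h *\<^sub>R Q) $ x $ y * exp (h * f $ y))"

lemma tilted_step_second_order:
  fixes Q :: "real ^ 'e ^ 'e::finite"
  obtains C where "C \<ge> 0"
    "\<And>h x y. \<lbrakk>0 \<le> h; h \<le> t\<rbrakk> \<Longrightarrow>
      \<bar>tilted_step Q f h $ x $ y - mat 1 $ x $ y - h * (Q $ x $ y + mat 1 $ x $ y * f $ y)\<bar>
        \<le> C * h\<^sup>2"
proof -
  obtain C0 where C0: "C0 \<ge> 0" "\<And>h x y. \<lbrakk>0 \<le> h; h \<le> t\<rbrakk> \<Longrightarrow>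
      \<bar>matrix_exp (h *\<^sub>R Q) $ x $ y - mat 1 $ x $ y - h * Q $ x $ y\<bar> \<le> C0 * h\<^sup>2"
    using matrix_exp_second_order by blast
  define F where "F = infnorm f"
  define q where "q = (\<Sum>x\<in>UNIV. \<Sum>y\<in>UNIV. \<bar>Q $ x $ y\<bar>)"
  have F: "F \<ge> 0" "\<bar>f $ y\<bar> \<le> F" for y
    by (simp_all add: F_def infnorm_pos_le component_le_infnorm_cart)
  have q: "\<bar>Q $ x $ y\<bar> \<le> q" for x y
    using matrix_power_entry_le[where A = Q and n = 1 and x = x and y = y] by (simp add: q_def)
  then have q0: "q \<ge> 0" by (meson abs_ge_zero order_trans)
  define E where "E = exp (t * F)"
  show thesis
  proof (rule that[of "E * (C0 + F\<^sup>2 + q * F)"])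
    show "0 \<le> E * (C0 + F\<^sup>2 + q * F)" using C0(1) F(1) q0 by (simp add: E_def)
    fix h :: real and x y assume h: "0 \<le> h" "h \<le> t"
    let ?z = "h * f $ y" and ?R = "matrix_exp (h *\<^sub>R Q) $ x $ y - mat 1 $ x $ y - h * Q $ x $ y"
    have z: "\<bar>?z\<bar> \<le> h * F" using h F(2)[of y] by (simp add: abs_mult mult_left_mono)
    also have "\<dots> \<le> t * F" using h F(1) by (simp add: mult_right_mono)
    finally have zE: "exp \<bar>?z\<bar> \<le> E" by (simp add: E_def)
    then have "exp ?z \<le> E" by (meson abs_ge_self exp_le_cancel_iff order_trans)
    then have 1: "\<bar>?R * exp ?z\<bar> \<le> C0 * h\<^sup>2 * E"
      unfolding abs_mult using C0(2)[OF h, of x y] C0(1) by (intro mult_mono) auto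
    have "\<bar>exp ?z - 1 - ?z\<bar> \<le> ?z\<^sup>2 * exp \<bar>?z\<bar>" by (rule exp_second_order_error)
    also have "\<dots> \<le> (h * F)\<^sup>2 * E"
      using z zE by (intro mult_mono) (auto simp flip: abs_le_square_iff)
    finally have 2: "\<bar>mat 1 $ x $ y * (exp ?z - 1 - ?z)\<bar> \<le> (h * F)\<^sup>2 * E"
      by (simp add: mat_def E_def)
    have "\<bar>exp ?z - 1\<bar> \<le> \<bar>?z\<bar> * exp \<bar>?z\<bar>" by (rule exp_first_order_error)
    also have "\<dots> \<le> (h * F) * E" using z zE h(1) F(1) by (intro mult_mono) auto
    finally have "\<bar>Q $ x $ y\<bar> * \<bar>exp ?z - 1\<bar> \<le> q * (h * F * E)"
      using q by (intro mult_mono q0) auto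
    then have 3: "\<bar>h * (Q $ x $ y * (exp ?z - 1))\<bar> \<le> h * (q * (h * F * E))"
      using h(1) by (simp add: abs_mult mult_left_mono)
    have "tilted_step Q f h $ x $ y - mat 1 $ x $ y - h * (Q $ x $ y + mat 1 $ x $ y * f $ y)
        = ?R * exp ?z + mat 1 $ x $ y * (exp ?z - 1 - ?z) + h * (Q $ x $ y * (exp ?z - 1))"
      by (simp add: tilted_step_def algebra_simps)
    also have "\<bar>\<dots>\<bar> \<le> C0 * h\<^sup>2 * E + (h * F)\<^sup>2 * E + h * (q * (h * F * E))"
      using 1 2 3 by linarith
    also have "\<dots> = E * (C0 + F\<^sup>2 + q * F) * h\<^sup>2"
      by (simp add: power2_eq_square algebra_simps)
    finally show "\<bar>tilted_step Q f h $ x $ y - mat 1 $ x $ y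
        - h * (Q $ x $ y + mat 1 $ x $ y * f $ y)\<bar> \<le> E * (C0 + F\<^sup>2 + q * F) * h\<^sup>2" .
  qed
qed

context ergodic_generator
begin

lemma norm_pi_matrix_le:
  obtains c where "c \<ge> 0"
    "\<And>A m g. (\<And>x y. \<bar>A $ x $ y\<bar> \<le> m) \<Longrightarrow> norm_pi \<pi> (A *v g) \<le> c * m * norm_pi \<pi> g"
proof (rule that[of "\<Sum>y\<in>UNIV. 1 / sqrt (pmf \<pi> y)"])
  let ?c = "\<Sum>y\<in>UNIV. 1 / sqrt (pmf \<pi> y)"
  show "?c \<ge> 0" by (simp add: sum_nonneg)
  fix A :: "real ^ 'e ^ 'e" and m g assume A: "\<And>x y. \<bar>A $ x $ y\<bar> \<le> m"
  have m: "m \<ge> 0" using A[of undefined undefined] by linarith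
  have g: "\<bar>g $ y\<bar> \<le> 1 / sqrt (pmf \<pi> y) * norm_pi \<pi> g" for y
  proof -
    have "sqrt ((g $ y)\<^sup>2 * pmf \<pi> y) \<le> norm_pi \<pi> g"
      unfolding norm_pi_def inner_pi_def power2_eq_square
      by (intro real_sqrt_le_mono member_le_sum) auto
    then show ?thesis using pi_pos[of y] by (simp add: real_sqrt_mult field_simps)
  qed
  show "norm_pi \<pi> (A *v g) \<le> ?c * m * norm_pi \<pi> g"
  proof (rule norm_pi_le)
    fix x
    have "\<bar>(A *v g) $ x\<bar> \<le> (\<Sum>y\<in>UNIV. \<bar>A $ x $ y\<bar> * \<bar>g $ y\<bar>)"
      by (simp add: matrix_vector_mult_def flip: abs_mult)
    also have "\<dots> \<le> (\<Sum>y\<in>UNIV. m * (1 / sqrt (pmf \<pi> y) * norm_pi \<pi> g))"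
      by (intro sum_mono mult_mono A g m) auto
    also have "\<dots> = ?c * m * norm_pi \<pi> g"
      by (simp add: sum_distrib_right sum_distrib_left mult_ac)
    finally show "\<bar>(A *v g) $ x\<bar> \<le> ?c * m * norm_pi \<pi> g" .
  qed
qed

text \<open>A bound on the quadratic form of \<open>Q + f\<close> controls the operator norm of a step, up to second
  order, because \<open>\<parallel>g + h (Q + f) g\<parallel>\<^sup>2 = \<parallel>g\<parallel>\<^sup>2 + 2 h \<langle>g, (Q + f) g\<rangle> + O(h\<^sup>2)\<close>.\<close>

lemma norm_pi_tilted_step_le:
  assumes form: "\<And>g. inner_pi \<pi> g (Q *v g) + inner_pi \<pi> g (\<chi> x. f $ x * g $ x) \<le> \<Gamma> * inner_pi \<pi> g g"
    and \<Gamma>: "\<Gamma> \<ge> 0"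
  obtains C where "C \<ge> 0"
    "\<And>h g. \<lbrakk>0 \<le> h; h \<le> t\<rbrakk> \<Longrightarrow>
      norm_pi \<pi> (tilted_step Q f h *v g) \<le> (1 + h * \<Gamma> + C * h\<^sup>2) * norm_pi \<pi> g"
proof -
  obtain C0 where C0: "C0 \<ge> 0" "\<And>h x y. \<lbrakk>0 \<le> h; h \<le> t\<rbrakk> \<Longrightarrow>
      \<bar>tilted_step Q f h $ x $ y - mat 1 $ x $ y - h * (Q $ x $ y + mat 1 $ x $ y * f $ y)\<bar>
        \<le> C0 * h\<^sup>2"
    using tilted_step_second_order by blast
  obtain c where c: "c \<ge> 0"
    "\<And>A m g. (\<And>x y. \<bar>A $ x $ y\<bar> \<le> m) \<Longrightarrow> norm_pi \<pi> (A *v g) \<le> c * m * norm_pi \<pi> g"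
    using norm_pi_matrix_le by blast
  define B where "B = (\<chi> x y. Q $ x $ y + mat 1 $ x $ y * f $ y)"
  have B: "B *v g = Q *v g + (\<chi> x. f $ x * g $ x)" for g
  proof -
    have "(\<Sum>y\<in>UNIV. mat 1 $ x $ y * f $ y * g $ y) = f $ x * g $ x" for x
      by (simp add: mat_def if_distribR if_distrib[of "\<lambda>a. a * _"] cong: if_cong)
    then show ?thesis
      by (simp add: B_def matrix_vector_mult_def vec_eq_iff distrib_right sum.distrib)
  qed
  have "\<bar>B $ x $ y\<bar> \<le> (\<Sum>x\<in>UNIV. \<Sum>y\<in>UNIV. \<bar>B $ x $ y\<bar>)" for x y
    using matrix_power_entry_le[where A = B and n = 1 and x = x and y = y] by simp
  then obtain \<beta> where \<beta>: "\<And>g. norm_pi \<pi> (B *v g) \<le> \<beta> * norm_pi \<pi> g" using c(2) by blast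
  show thesis
  proof (rule that[of "\<beta>\<^sup>2 / 2 + c * C0"])
    show "0 \<le> \<beta>\<^sup>2 / 2 + c * C0" using c(1) C0(1) by simp
    fix h g assume h: "0 \<le> h" "h \<le> t"
    define R where "R = (\<chi> x y. tilted_step Q f h $ x $ y - mat 1 $ x $ y - h * B $ x $ y)"
    have "tilted_step Q f h = mat 1 + h *\<^sub>R B + R" by (simp add: R_def vec_eq_iff)
    then have split: "tilted_step Q f h *v g = (g + h *\<^sub>R (B *v g)) + R *v g"
      by (simp add: matrix_vector_mult_add_rdistrib scaleR_matrix_vector_assoc)
    have "norm_pi \<pi> (R *v g) \<le> c * (C0 * h\<^sup>2) * norm_pi \<pi> g"
      by (rule c(2)) (use C0(2)[OF h] in \<open>simp add: R_def B_def\<close>)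
    moreover have "norm_pi \<pi> (g + h *\<^sub>R (B *v g)) \<le> (1 + h * \<Gamma> + h\<^sup>2 * \<beta>\<^sup>2 / 2) * norm_pi \<pi> g"
    proof (rule power2_le_imp_le)
      let ?a = "1 + h * \<Gamma> + h\<^sup>2 * \<beta>\<^sup>2 / 2"
      have "(norm_pi \<pi> (B *v g))\<^sup>2 \<le> (\<beta> * norm_pi \<pi> g)\<^sup>2"
        by (rule power_mono[OF \<beta> norm_pi_nonneg])
      then have "h\<^sup>2 * inner_pi \<pi> (B *v g) (B *v g) \<le> h\<^sup>2 * (\<beta>\<^sup>2 * inner_pi \<pi> g g)"
        by (intro mult_left_mono) (simp_all add: norm_pi_sq power_mult_distrib)
      moreover have "h * inner_pi \<pi> g (B *v g) \<le> h * (\<Gamma> * inner_pi \<pi> g g)"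
        using form[of g] h(1) by (intro mult_left_mono) (simp_all add: B)
      moreover have "(norm_pi \<pi> (g + h *\<^sub>R (B *v g)))\<^sup>2
          = inner_pi \<pi> g g + 2 * (h * inner_pi \<pi> g (B *v g)) + h\<^sup>2 * inner_pi \<pi> (B *v g) (B *v g)"
        unfolding norm_pi_sq
        by (simp add: inner_pi_commute[of _ "B *v g" g] power2_eq_square algebra_simps)
      ultimately have "(norm_pi \<pi> (g + h *\<^sub>R (B *v g)))\<^sup>2
          \<le> inner_pi \<pi> g g + 2 * (h * (\<Gamma> * inner_pi \<pi> g g)) + h\<^sup>2 * (\<beta>\<^sup>2 * inner_pi \<pi> g g)"
        by linarith
      also have "\<dots> = (1 + 2 * (h * \<Gamma> + h\<^sup>2 * \<beta>\<^sup>2 / 2)) * inner_pi \<pi> g g"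
        by (simp add: algebra_simps)
      also have "\<dots> \<le> ?a\<^sup>2 * inner_pi \<pi> g g"
      proof (rule mult_right_mono[OF _ inner_pi_self_nonneg])
        have "?a\<^sup>2 = 1 + 2 * (h * \<Gamma> + h\<^sup>2 * \<beta>\<^sup>2 / 2) + (h * \<Gamma> + h\<^sup>2 * \<beta>\<^sup>2 / 2)\<^sup>2"
          by (simp add: power2_eq_square algebra_simps)
        then show "1 + 2 * (h * \<Gamma> + h\<^sup>2 * \<beta>\<^sup>2 / 2) \<le> ?a\<^sup>2" by (simp only: le_add_same_cancel1 zero_le_power2)
      qed
      also have "\<dots> = (?a * norm_pi \<pi> g)\<^sup>2" by (simp add: power_mult_distrib norm_pi_sq)
      finally show "(norm_pi \<pi> (g + h *\<^sub>R (B *v g)))\<^sup>2 \<le> (?a * norm_pi \<pi> g)\<^sup>2" .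
      show "0 \<le> ?a * norm_pi \<pi> g" 
        using h(1) \<Gamma> by (intro mult_nonneg_nonneg add_nonneg_nonneg norm_pi_nonneg) auto
    qed
    ultimately show "norm_pi \<pi> (tilted_step Q f h *v g)
        \<le> (1 + h * \<Gamma> + (\<beta>\<^sup>2 / 2 + c * C0) * h\<^sup>2) * norm_pi \<pi> g"
      unfolding split
      using norm_pi_triangle[of \<pi> "g + h *\<^sub>R (B *v g)" "R *v g"] by (simp add: algebra_simps)
  qed
qed

lemma norm_pi_tilted_iterates_le:
  assumes form: "\<And>g. inner_pi \<pi> g (Q *v g) + inner_pi \<pi> g (\<chi> x. f $ x * g $ x) \<le> \<Gamma> * inner_pi \<pi> g g"
    and \<Gamma>: "\<Gamma> \<ge> 0" and t: "t \<ge> 0"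
  obtains C where "\<And>n. n > 0 \<Longrightarrow>
    norm_pi \<pi> (((*v) (tilted_step Q f (t / real n)) ^^ n) (vec 1)) \<le> exp (t * \<Gamma> + C / real n)"
proof -
  obtain C where C: "C \<ge> 0" "\<And>h g. \<lbrakk>0 \<le> h; h \<le> t\<rbrakk> \<Longrightarrow>
      norm_pi \<pi> (tilted_step Q f h *v g) \<le> (1 + h * \<Gamma> + C * h\<^sup>2) * norm_pi \<pi> g"
    using norm_pi_tilted_step_le[OF form \<Gamma>] by blast
  show thesis
  proof (rule that[of "C * t\<^sup>2"])
    fix n :: nat assume n: "n > 0"
    define h where "h = t / real n"
    have "t * 1 \<le> t * real n" using n t by (intro mult_left_mono) auto
    then have h: "0 \<le> h" "h \<le> t" using n t by (simp_all add: h_def divide_le_eq)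
    let ?a = "1 + h * \<Gamma> + C * h\<^sup>2"
    have a: "?a \<ge> 0" using C(1) \<Gamma> h by simp
    have "norm_pi \<pi> (((*v) (tilted_step Q f h) ^^ k) (vec 1)) \<le> ?a ^ k" for k
    proof (induction k)
      case 0
      then show ?case using norm_pi_vec_1[of \<pi>] by simp
    next
      case (Suc k)
      have "norm_pi \<pi> (((*v) (tilted_step Q f h) ^^ Suc k) (vec 1))
          \<le> ?a * norm_pi \<pi> (((*v) (tilted_step Q f h) ^^ k) (vec 1))"
        using C(2)[OF h] by simp
      also have "\<dots> \<le> ?a * ?a ^ k" by (rule mult_left_mono[OF Suc.IH a])
      finally show ?case by simp
    qed
    then have "norm_pi \<pi> (((*v) (tilted_step Q f h) ^^ n) (vec 1)) \<le> ?a ^ n" .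
    also have "\<dots> \<le> exp (h * \<Gamma> + C * h\<^sup>2) ^ n"
      using exp_ge_add_one_self[of "h * \<Gamma> + C * h\<^sup>2"] by (intro power_mono a) (simp add: add.assoc)
    also have "\<dots> = exp (real n * (h * \<Gamma> + C * h\<^sup>2))" by (simp add: exp_of_nat_mult)
    also have "real n * (h * \<Gamma> + C * h\<^sup>2) = t * \<Gamma> + C * t\<^sup>2 / real n"
      using n by (simp add: h_def field_simps power2_eq_square)
    finally show "norm_pi \<pi> (((*v) (tilted_step Q f (t / real n)) ^^ n) (vec 1))
        \<le> exp (t * \<Gamma> + C * t\<^sup>2 / real n)"
      by (simp only: h_def)
  qed
qed

end


section \<open>Riemann sums of jump paths\<close>

text \<open>Each right-endpoint Riemann sum is the integral of the path evaluated at the next grid point.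
  Grid points approach from the right, so that right-continuity makes these integrands converge
  everywhere, and dominated convergence applies.\<close>

lemma has_integral_next_grid_point:
  fixes c :: "real \<Rightarrow> real"
  assumes h: "h > 0"
  shows "((\<lambda>s. c (real_of_int \<lceil>s / h\<rceil> * h)) has_integral (h * (\<Sum>k=1..n. c (real k * h)))) {0..real n * h}"
proof (induction n)
  case 0
  then show ?case using has_integral_refl(2)[of _ 0] by simp
next
  case (Suc n)
  let ?g = "\<lambda>s. c (real_of_int \<lceil>s / h\<rceil> * h)"
  have "measure lborel {real n * h..real (Suc n) * h} = h" using h by (simp add: algebra_simps)
  then have const: "((\<lambda>_. c (real (Suc n) * h)) has_integral h * c (real (Suc n) * h))
      {real n * h..real (Suc n) * h}"
    using has_integral_const_real[of "c (real (Suc n) * h)" "real n * h" "real (Suc n) * h"]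
    by (simp only: real_scaleR_def)
  have "(?g has_integral h * c (real (Suc n) * h)) {real n * h..real (Suc n) * h}"
  proof (rule has_integral_spike_finite[OF _ _ const])
    show "finite {real n * h}" by simp
    fix s assume "s \<in> {real n * h..real (Suc n) * h} - {real n * h}"
    then have "\<lceil>s / h\<rceil> = int (Suc n)"
      using h by (intro ceiling_unique) (auto simp: field_simps)
    then show "?g s = c (real (Suc n) * h)" by simp
  qed
  with Suc.IH have "(?g has_integral h * (\<Sum>k=1..n. c (real k * h)) + h * c (real (Suc n) * h)) {0..real (Suc n) * h}"
    using h by (intro has_integral_combine[of 0 "real n * h"]) auto
  then show ?case by (simp add: algebra_simps)
qed

lemma Riemann_sums_right_continuous:
  fixes w :: "real \<Rightarrow> 'e::finite" and c :: "'e \<Rightarrow> real"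
  assumes right: "\<And>s. s \<ge> 0 \<Longrightarrow> \<forall>\<^sub>F s' in at_right s. w s' = w s" and t: "t > 0"
  shows "(\<lambda>n. t / real (Suc n) * (\<Sum>k=1..Suc n. c (w (real k * (t / real (Suc n))))))
    \<longlonglongrightarrow> integral {0..t} (\<lambda>s. c (w s))"
proof -
  define h where "h n = t / real (Suc n)" for n
  have h: "h n > 0" "real (Suc n) * h n = t" for n using t by (simp_all add: h_def)
  define p where "p n s = real_of_int \<lceil>s / h n\<rceil> * h n" for n s
  have p: "s \<le> p n s" "p n s < s + h n" for n s
  proof -
    have "s / h n \<le> \<lceil>s / h n\<rceil>" "\<lceil>s / h n\<rceil> < s / h n + 1" by linarith+
    then show "s \<le> p n s" "p n s < s + h n"
      unfolding p_def pos_divide_le_eq[OF h(1)] using h(1)[of n] by (simp_all add: field_simps)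
  qed
  have int: "((\<lambda>s. c (w (p n s))) has_integral h n * (\<Sum>k=1..Suc n. c (w (real k * h n)))) {0..t}" for n
    using has_integral_next_grid_point[OF h(1), of "\<lambda>s. c (w s)" n "Suc n"] by (simp only: p_def h(2))
  have h0: "h \<longlonglongrightarrow> 0"
    unfolding h_def using tendsto_mult_right_zero[OF LIMSEQ_inverse_real_of_nat, of t]
    by (simp only: divide_inverse)
  have conv: "(\<lambda>n. c (w (p n s))) \<longlonglongrightarrow> c (w s)" if s: "s \<ge> 0" for s
  proof -
    obtain e where e: "e > 0" "\<And>s'. s < s' \<Longrightarrow> s' < s + e \<Longrightarrow> w s' = w s"
      using right[OF s] unfolding eventually_at_right_field
      by (metis add_diff_cancel_left' diff_add_cancel less_add_same_cancel1 diff_gt_0_iff_gt add.commute)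
    have "\<forall>\<^sub>F n in sequentially. h n < e"
      using h0 e(1) by (rule order_tendstoD)
    then have "\<forall>\<^sub>F n in sequentially. c (w (p n s)) = c (w s)"
    proof eventually_elim
      case (elim n)
      then have "p n s = s \<or> (s < p n s \<and> p n s < s + e)" using p[where n = n and s = s] by linarith
      then show ?case using e(2) by metis
    qed
    then show ?thesis by (rule tendsto_eventually)
  qed
  have bound: "norm (c (w (p n s))) \<le> (\<Sum>x\<in>UNIV. \<bar>c x\<bar>)" for n s
    using member_le_sum[of "w (p n s)" UNIV "\<lambda>x. \<bar>c x\<bar>"] by simp
  have "(\<lambda>n. integral {0..t} (\<lambda>s. c (w (p n s)))) \<longlonglongrightarrow> integral {0..t} (\<lambda>s. c (w s))"
    by (rule dominated_convergence(2)[where h = "\<lambda>_. \<Sum>x\<in>UNIV. \<bar>c x\<bar>"])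
      (use int bound conv in \<open>auto intro: has_integral_integrable\<close>)
  then show ?thesis unfolding integral_unique[OF int] by (simp only: h_def)
qed


section \<open>Exponential moments of the additive functional\<close>

context markov_jump_process
begin

lemma space_P: "space (P x) = space M"
  by (rule sets_eq_imp_space_eq[OF sets_P])

lemma measurable_P: "measurable (P x) N = measurable M N"
  by (rule measurable_cong_sets[OF sets_P refl])

lemma observable_measurable: "0 \<le> r \<Longrightarrow> (\<lambda>\<omega>. g (X r \<omega>)) \<in> borel_measurable M" for g :: "'e \<Rightarrow> real"
  by (rule measurable_compose[OF measurable_X]) auto

lemma natural_filtration_generator:
  "{X r -` A \<inter> space M | r A. 0 \<le> r \<and> r \<le> s} \<subseteq> sets M"
  using measurable_sets[OF measurable_X] by auto

lemma natural_filtration_subalgebra: "subalgebra (P x) (natural_filtration M X s)"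
proof -
  have "sigma_sets (space M) {X r -` A \<inter> space M | r A. 0 \<le> r \<and> r \<le> s} \<subseteq> sets M"
    by (rule sets.sigma_sets_subset[OF natural_filtration_generator])
  moreover have "{X r -` A \<inter> space M | r A. 0 \<le> r \<and> r \<le> s} \<subseteq> Pow (space M)" by auto
  ultimately show ?thesis
    by (simp add: subalgebra_def natural_filtration_def space_P sets_P space_measure_of_conv
        sets_measure_of)
qed

lemma observable_adapted:
  fixes g :: "'e \<Rightarrow> real"
  assumes "0 \<le> r" "r \<le> s"
  shows "(\<lambda>\<omega>. g (X r \<omega>)) \<in> borel_measurable (natural_filtration M X s)"
proof -
  have "X r \<in> measurable (natural_filtration M X s) (count_space UNIV)"
  proof (rule measurableI)
    fix A :: "'e set"
    have "X r -` A \<inter> space M \<in> {X r -` A \<inter> space M | r A. 0 \<le> r \<and> r \<le> s}" using assms by auto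
    then show "X r -` A \<inter> space (natural_filtration M X s) \<in> sets (natural_filtration M X s)"
      unfolding natural_filtration_def by (subst sets_measure_of) (auto simp: space_measure_of_conv)
  qed simp
  from measurable_compose[OF this, of g borel] show ?thesis by simp
qed

text \<open>The Markov property is given for the indicators of single states; since the state space is finite,
  every function of the state is a linear combination of these.\<close>

lemma Markov_expectation:
  fixes g :: "'e \<Rightarrow> real"
  assumes s: "0 \<le> s" and h: "0 \<le> h"
    and Z: "Z \<in> borel_measurable (natural_filtration M X s)" "\<And>\<omega>. \<bar>Z \<omega>\<bar> \<le> b"
  shows "(\<integral>\<omega>. Z \<omega> * g (X (s + h) \<omega>) \<partial>P x)
    = (\<integral>\<omega>. Z \<omega> * (\<Sum>y\<in>UNIV. transition_fun P X h (X s \<omega>) y * g y) \<partial>P x)"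
proof -
  interpret prob_space "P x" by (rule prob_space_P)
  interpret finite_measure_subalgebra "P x" "natural_filtration M X s"
    by unfold_locales (rule natural_filtration_subalgebra)
  let ?I = "\<lambda>y. indicator {\<omega> \<in> space M. X (s + h) \<omega> = y} :: _ \<Rightarrow> real"
  have Zm: "Z \<in> borel_measurable (P x)"
    by (rule measurable_from_subalg[OF natural_filtration_subalgebra Z(1)])
  have I_sets: "{\<omega> \<in> space M. X (s + h) \<omega> = y} \<in> sets (P x)" for y
  proof -
    have "{\<omega> \<in> space M. X (s + h) \<omega> = y} = X (s + h) -` {y} \<inter> space M" by auto
    then show ?thesis using measurable_sets[OF measurable_X, of "s + h" "{y}"] s h by (simp add: sets_P)
  qed
  have I_int: "integrable (P x) (\<lambda>\<omega>. Z \<omega> * ?I y \<omega>)" for y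
  proof (rule integrable_const_bound[of _ b])
    have "\<bar>Z \<omega> * ?I y \<omega>\<bar> \<le> b * 1" for \<omega>
      unfolding abs_mult using Z(2)[of \<omega>]
      by (intro mult_mono) (auto simp: indicator_def intro: order_trans[OF abs_ge_zero])
    then show "AE \<omega> in P x. norm (Z \<omega> * ?I y \<omega>) \<le> b" by simp
    show "(\<lambda>\<omega>. Z \<omega> * ?I y \<omega>) \<in> borel_measurable (P x)"
      using I_sets by (intro borel_measurable_times Zm borel_measurable_indicator)
  qed
  have transition_int: "integrable (P x) (\<lambda>\<omega>. Z \<omega> * transition_fun P X h (X s \<omega>) y)" for y
  proof (rule integrable_const_bound[of _ b])
    have "transition_fun P X h z y \<in> {0..1}" for z
      unfolding transition_fun_def using prob_space.prob_le_1[OF prob_space_P] by auto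
    then have "\<bar>Z \<omega> * transition_fun P X h (X s \<omega>) y\<bar> \<le> b * 1" for \<omega>
      unfolding abs_mult using Z(2)[of \<omega>] by (intro mult_mono) (auto intro: order_trans[OF abs_ge_zero])
    then show "AE \<omega> in P x. norm (Z \<omega> * transition_fun P X h (X s \<omega>) y) \<le> b" by simp
    show "(\<lambda>\<omega>. Z \<omega> * transition_fun P X h (X s \<omega>) y) \<in> borel_measurable (P x)"
      by (intro borel_measurable_times Zm) (use observable_measurable[OF s] in \<open>simp add: measurable_P\<close>)
  qed
  have step: "(\<integral>\<omega>. Z \<omega> * ?I y \<omega> \<partial>P x) = (\<integral>\<omega>. Z \<omega> * transition_fun P X h (X s \<omega>) y \<partial>P x)" for y
  proof -
    have "(\<integral>\<omega>. Z \<omega> * ?I y \<omega> \<partial>P x)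
        = (\<integral>\<omega>. Z \<omega> * real_cond_exp (P x) (natural_filtration M X s) (?I y) \<omega> \<partial>P x)"
      by (rule real_cond_exp_intg(2)[symmetric]) (use I_int Z(1) I_sets in auto)
    also have "\<dots> = (\<integral>\<omega>. Z \<omega> * transition_fun P X h (X s \<omega>) y \<partial>P x)"
    proof (rule integral_cong_AE)
      show "(\<lambda>\<omega>. Z \<omega> * real_cond_exp (P x) (natural_filtration M X s) (?I y) \<omega>) \<in> borel_measurable (P x)"
        using Zm by simp
      show "(\<lambda>\<omega>. Z \<omega> * transition_fun P X h (X s \<omega>) y) \<in> borel_measurable (P x)"
        using transition_int by simp
      show "AE \<omega> in P x. Z \<omega> * real_cond_exp (P x) (natural_filtration M X s) (?I y) \<omega>
          = Z \<omega> * transition_fun P X h (X s \<omega>) y"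
        using Markov[OF s h, where x = x and y = y] by eventually_elim simp
    qed
    finally show ?thesis .
  qed
  have "(\<integral>\<omega>. Z \<omega> * g (X (s + h) \<omega>) \<partial>P x) = (\<integral>\<omega>. (\<Sum>y\<in>UNIV. g y * (Z \<omega> * ?I y \<omega>)) \<partial>P x)"
  proof (rule Bochner_Integration.integral_cong[OF refl])
    fix \<omega> assume "\<omega> \<in> space (P x)"
    then have "g y * (Z \<omega> * ?I y \<omega>) = (if y = X (s + h) \<omega> then g y * Z \<omega> else 0)" for y
      by (auto simp: space_P indicator_def)
    then show "Z \<omega> * g (X (s + h) \<omega>) = (\<Sum>y\<in>UNIV. g y * (Z \<omega> * ?I y \<omega>))"
      by (simp add: mult.commute)
  qed
  also have "\<dots> = (\<Sum>y\<in>UNIV. g y * (\<integral>\<omega>. Z \<omega> * ?I y \<omega> \<partial>P x))"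
    using I_int by (subst Bochner_Integration.integral_sum) auto
  also have "\<dots> = (\<integral>\<omega>. (\<Sum>y\<in>UNIV. g y * (Z \<omega> * transition_fun P X h (X s \<omega>) y)) \<partial>P x)"
    unfolding step using transition_int by (subst Bochner_Integration.integral_sum) auto
  also have "\<dots> = (\<integral>\<omega>. Z \<omega> * (\<Sum>y\<in>UNIV. transition_fun P X h (X s \<omega>) y * g y) \<partial>P x)"
    by (simp add: sum_distrib_left mult_ac)
  finally show ?thesis .
qed

text \<open>The Markov property removes the last factor of the product at the price of one application of
  the matrix, hence the induction with an arbitrary terminal function \<open>g\<close>.\<close>

lemma expectation_grid_product:
  fixes e :: "'e \<Rightarrow> real"
  assumes h: "0 \<le> h"
  shows "(\<integral>\<omega>. (\<Prod>k=1..n. e (X (real k * h) \<omega>)) * g $ X (real n * h) \<omega> \<partial>P x)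
    = ((*v) (\<chi> x y. transition_fun P X h x y * e y) ^^ n) g $ x"
proof (induction n arbitrary: g)
  case 0
  interpret prob_space "P x" by (rule prob_space_P)
  have "AE \<omega> in P x. X 0 \<omega> = x"
    using AE_prob_1[OF initial] by eventually_elim simp
  then have "(\<integral>\<omega>. g $ X 0 \<omega> \<partial>P x) = (\<integral>\<omega>. g $ x \<partial>P x)"
    by (intro integral_cong_AE) (auto simp: measurable_P observable_measurable)
  then show ?case by (simp add: prob_space)
next
  case (Suc n)
  let ?T = "\<chi> x y. transition_fun P X h x y * e y"
  let ?Z = "\<lambda>\<omega>. \<Prod>k=1..n. e (X (real k * h) \<omega>)"
  have "\<bar>e y\<bar> \<le> (\<Sum>z\<in>UNIV. \<bar>e z\<bar>)" for y by (rule member_le_sum) auto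
  then have Z_bound: "\<bar>?Z \<omega>\<bar> \<le> (\<Sum>z\<in>UNIV. \<bar>e z\<bar>) ^ n" for \<omega>
    unfolding abs_prod using prod_mono[of "{1..n}" "\<lambda>k. \<bar>e (X (real k * h) \<omega>)\<bar>" "\<lambda>_. \<Sum>z\<in>UNIV. \<bar>e z\<bar>"]
    by simp
  have Z_adapted: "?Z \<in> borel_measurable (natural_filtration M X (real n * h))"
    using h by (intro borel_measurable_prod observable_adapted) (auto intro: mult_right_mono)
  have "(\<integral>\<omega>. (\<Prod>k=1..Suc n. e (X (real k * h) \<omega>)) * g $ X (real (Suc n) * h) \<omega> \<partial>P x)
      = (\<integral>\<omega>. ?Z \<omega> * (e (X (real n * h + h) \<omega>) * g $ X (real n * h + h) \<omega>) \<partial>P x)"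
    by (simp add: algebra_simps)
  also have "\<dots> = (\<integral>\<omega>. ?Z \<omega> * (\<Sum>y\<in>UNIV. transition_fun P X h (X (real n * h) \<omega>) y * (e y * g $ y)) \<partial>P x)"
    by (rule Markov_expectation[OF _ h Z_adapted Z_bound, where g = "\<lambda>y. e y * g $ y"]) (simp add: h)
  also have "\<dots> = (\<integral>\<omega>. ?Z \<omega> * (?T *v g) $ X (real n * h) \<omega> \<partial>P x)"
    by (simp add: matrix_vector_mult_def mult.assoc)
  also have "\<dots> = ((*v) ?T ^^ n) (?T *v g) $ x" by (rule Suc.IH)
  also have "\<dots> = ((*v) ?T ^^ Suc n) g $ x" by (simp only: funpow_Suc_right o_apply)
  finally show ?case .
qed

lemma Riemann_sum_additive_functional:
  assumes "\<omega> \<in> space M" "t > 0"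
  shows "(\<lambda>n. t / real (Suc n) * (\<Sum>k=1..Suc n. f $ X (real k * (t / real (Suc n))) \<omega>))
    \<longlonglongrightarrow> additive_functional X f t \<omega>"
  unfolding additive_functional_def
  using Riemann_sums_right_continuous[of "\<lambda>s. X s \<omega>" t "($) f"] jump_paths[OF assms(1)] assms(2)
  by (simp add: jump_path_def)

lemma Riemann_sum_measurable:
  assumes "t > 0"
  shows "(\<lambda>\<omega>. t / real (Suc n) * (\<Sum>k=1..Suc n. f $ X (real k * (t / real (Suc n))) \<omega>))
    \<in> borel_measurable M"
  by (intro borel_measurable_times borel_measurable_const borel_measurable_sum observable_measurable)
    (use assms in auto)

lemma additive_functional_measurable:
  assumes "t > 0" shows "additive_functional X f t \<in> borel_measurable M"
  by (rule borel_measurable_LIMSEQ_metric[OF Riemann_sum_measurable Riemann_sum_additive_functional])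
    (use assms in auto)

lemma Riemann_sum_le:
  assumes "t > 0"
  shows "t / real (Suc n) * (\<Sum>k=1..Suc n. f $ X (real k * (t / real (Suc n))) \<omega>) \<le> t * infnorm f"
proof -
  have "(\<Sum>k=1..Suc n. f $ X (real k * (t / real (Suc n))) \<omega>) \<le> (\<Sum>k=1..Suc n. infnorm f)"
    using component_le_infnorm_cart[of f] abs_le_D1 by (intro sum_mono) blast
  also have "\<dots> = real (Suc n) * infnorm f" by simp
  finally have "t / real (Suc n) * (\<Sum>k=1..Suc n. f $ X (real k * (t / real (Suc n))) \<omega>)
      \<le> t / real (Suc n) * (real (Suc n) * infnorm f)"
    using assms by (intro mult_left_mono) auto
  then show ?thesis by simp
qed

lemma exponential_moment_limit:
  fixes f :: "real ^ 'e"
  assumes t: "t > 0"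
  shows "integrable (P x) (\<lambda>\<omega>. exp (additive_functional X f t \<omega>))"
    and "(\<lambda>n. \<integral>\<omega>. exp (t / real (Suc n) * (\<Sum>k=1..Suc n. f $ X (real k * (t / real (Suc n))) \<omega>)) \<partial>P x)
      \<longlonglongrightarrow> (\<integral>\<omega>. exp (additive_functional X f t \<omega>) \<partial>P x)"
proof -
  interpret prob_space "P x" by (rule prob_space_P)
  let ?R = "\<lambda>n \<omega>. t / real (Suc n) * (\<Sum>k=1..Suc n. f $ X (real k * (t / real (Suc n))) \<omega>)"
  have lim: "AE \<omega> in P x. (\<lambda>n. exp (?R n \<omega>)) \<longlonglongrightarrow> exp (additive_functional X f t \<omega>)"
    using Riemann_sum_additive_functional[OF _ t]
    by (intro AE_I2 tendsto_exp) (simp add: space_P)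
  have bound: "AE \<omega> in P x. norm (exp (?R n \<omega>)) \<le> exp (t * infnorm f)" for n
    using Riemann_sum_le[OF t] by (intro AE_I2) simp
  have m1: "(\<lambda>\<omega>. exp (additive_functional X f t \<omega>)) \<in> borel_measurable (P x)"
    unfolding measurable_P using additive_functional_measurable[OF t] by simp
  have m2: "(\<lambda>\<omega>. exp (?R n \<omega>)) \<in> borel_measurable (P x)" for n
    unfolding measurable_P by (rule measurable_compose[OF Riemann_sum_measurable[OF t] borel_measurable_exp])
  show "integrable (P x) (\<lambda>\<omega>. exp (additive_functional X f t \<omega>))"
    by (rule integrable_dominated_convergence[OF m1 m2 _ lim bound]) simp
  show "(\<lambda>n. \<integral>\<omega>. exp (?R n \<omega>) \<partial>P x) \<longlonglongrightarrow> (\<integral>\<omega>. exp (additive_functional X f t \<omega>) \<partial>P x)"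
    by (rule integral_dominated_convergence[OF m1 m2 _ lim bound]) simp
qed

lemma exponential_moment_Riemann_sum:
  fixes f :: "real ^ 'e"
  assumes gen: "generator_matrix P X Q" and t: "t > 0" and n: "n > 0"
  shows "(\<integral>\<omega>. exp (t / real n * (\<Sum>k=1..n. f $ X (real k * (t / real n)) \<omega>)) \<partial>P x)
    = ((*v) (tilted_step Q f (t / real n)) ^^ n) (vec 1) $ x"
proof -
  let ?h = "t / real n"
  have h: "0 \<le> ?h" using t by simp
  have "tilted_step Q f ?h = (\<chi> x y. transition_fun P X ?h x y * exp (?h * f $ y))"
    using gen h by (simp add: tilted_step_def generator_matrix_def)
  then have "((*v) (tilted_step Q f ?h) ^^ n) (vec 1) $ x
      = (\<integral>\<omega>. (\<Prod>k=1..n. exp (?h * f $ X (real k * ?h) \<omega>)) * vec 1 $ X (real n * ?h) \<omega> \<partial>P x)"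
    by (simp only: expectation_grid_product[OF h, where e = "\<lambda>y. exp (?h * f $ y)"])
  then show ?thesis by (simp add: exp_sum sum_distrib_left)
qed

text \<open>\<open>\<Sum>x. \<nu> x * (T^n 1) x\<close> is the \<open>L\<^sup>2(\<pi>)\<close> inner product of \<open>d\<nu>/d\<pi>\<close> with \<open>T^n 1\<close>; this is how
  the density enters, by Cauchy-Schwarz.\<close>

lemma exponential_moment_le:
  fixes f :: "real ^ 'e"
  assumes erg: "ergodic_generator Q \<pi>" and gen: "generator_matrix P X Q" and t: "t > 0"
    and form: "\<And>g. inner_pi \<pi> g (Q *v g) + inner_pi \<pi> g (\<chi> x. f $ x * g $ x) \<le> \<Gamma> * inner_pi \<pi> g g"
    and \<Gamma>: "\<Gamma> \<ge> 0"
  shows "(\<Sum>x\<in>UNIV. pmf \<nu> x * (\<integral>\<omega>. exp (additive_functional X f t \<omega>) \<partial>P x))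
    \<le> norm_pi \<pi> (density_wrt \<nu> \<pi>) * exp (t * \<Gamma>)"
proof -
  interpret ergodic_generator Q \<pi> by (rule erg)
  let ?T = "\<lambda>n. ((*v) (tilted_step Q f (t / real n)) ^^ n) (vec 1)"
  obtain C where C: "\<And>n. n > 0 \<Longrightarrow> norm_pi \<pi> (?T n) \<le> exp (t * \<Gamma> + C / real n)"
    using norm_pi_tilted_iterates_le[OF form \<Gamma>, of t] t by auto
  have lim: "(\<lambda>n. \<Sum>x\<in>UNIV. pmf \<nu> x * ?T (Suc n) $ x)
      \<longlonglongrightarrow> (\<Sum>x\<in>UNIV. pmf \<nu> x * (\<integral>\<omega>. exp (additive_functional X f t \<omega>) \<partial>P x))"
  proof (intro tendsto_sum tendsto_mult tendsto_const)
    fix x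
    show "(\<lambda>n. ?T (Suc n) $ x) \<longlonglongrightarrow> (\<integral>\<omega>. exp (additive_functional X f t \<omega>) \<partial>P x)"
      using exponential_moment_limit(2)[OF t, of x f]
      by (simp only: exponential_moment_Riemann_sum[OF gen t zero_less_Suc])
  qed
  have lim_bound: "(\<lambda>n. norm_pi \<pi> (density_wrt \<nu> \<pi>) * exp (t * \<Gamma> + C / real (Suc n)))
      \<longlonglongrightarrow> norm_pi \<pi> (density_wrt \<nu> \<pi>) * exp (t * \<Gamma> + 0)"
    using LIMSEQ_Suc[OF lim_const_over_n[of C]] by (intro tendsto_intros) simp
  have "(\<Sum>x\<in>UNIV. pmf \<nu> x * ?T (Suc n) $ x)
      \<le> norm_pi \<pi> (density_wrt \<nu> \<pi>) * exp (t * \<Gamma> + C / real (Suc n))" for n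
  proof -
    have "(\<Sum>x\<in>UNIV. pmf \<nu> x * ?T (Suc n) $ x) = inner_pi \<pi> (density_wrt \<nu> \<pi>) (?T (Suc n))"
      unfolding inner_pi_def density_wrt_def
      by (rule sum.cong) (use pi_pos in \<open>simp_all add: less_imp_neq[symmetric]\<close>)
    also have "\<dots> \<le> norm_pi \<pi> (density_wrt \<nu> \<pi>) * norm_pi \<pi> (?T (Suc n))"
      by (rule inner_pi_Cauchy_Schwarz)
    also have "\<dots> \<le> norm_pi \<pi> (density_wrt \<nu> \<pi>) * exp (t * \<Gamma> + C / real (Suc n))"
      by (rule mult_left_mono[OF C norm_pi_nonneg]) simp
    finally show ?thesis .
  qed
  then show ?thesis using LIMSEQ_le[OF lim lim_bound] by simp
qed

lemma additive_functional_scaleR: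
  "additive_functional X (r *\<^sub>R f) t \<omega> = r * additive_functional X f t \<omega>"
  by (simp add: additive_functional_def)

text \<open>Chernoff's inequality with a free parameter \<open>r\<close>: \<^const>\<open>G_fun\<close> plays the part of the cumulant
  generating function of \<open>A\<^sub>t\<close> per unit of time.\<close>

lemma tail_bound:
  fixes f :: "real ^ 'e"
  assumes erg: "ergodic_generator Q \<pi>" and gen: "generator_matrix P X Q" and t: "t > 0"
    and f: "mean \<pi> f = 0" and r: "0 \<le> r" "2 * (infnorm f / spectral_gap \<pi> Q) * r < 1"
  shows "prob_from P \<nu> {\<omega> \<in> space M. additive_functional X f t \<omega> / t \<ge> u}
    \<le> norm_pi \<pi> (density_wrt \<nu> \<pi>)
      * exp (- (t * (r * u - G_fun (spectral_gap \<pi> Q) (infnorm f) (sigma_hat_sq \<pi> Q f) r)))"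
proof -
  interpret ergodic_generator Q \<pi> by (rule erg)
  define \<Gamma> where "\<Gamma> = G_fun (spectral_gap \<pi> Q) (infnorm f) (sigma_hat_sq \<pi> Q f) r"
  have \<Gamma>: "\<Gamma> \<ge> 0"
  proof -
    have "sigma_hat_sq \<pi> Q f \<ge> 0" using sigma_hat_sq_eq[OF f] K_nonpos by simp
    then show ?thesis using r(2) by (simp add: \<Gamma>_def G_fun_def)
  qed
  have form: "inner_pi \<pi> g (Q *v g) + inner_pi \<pi> g (\<chi> x. (r *\<^sub>R f) $ x * g $ x) \<le> \<Gamma> * inner_pi \<pi> g g" for g
  proof -
    have "inner_pi \<pi> g (\<chi> x. (r *\<^sub>R f) $ x * g $ x) = r * inner_pi \<pi> g (\<chi> x. f $ x * g $ x)"
      by (simp add: inner_pi_def sum_distrib_left mult_ac)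
    then show ?thesis using tilted_form_le[OF f r, of g] by (simp add: \<Gamma>_def)
  qed
  let ?A = "additive_functional X f t"
  have "measure (P x) {\<omega> \<in> space M. ?A \<omega> / t \<ge> u}
      \<le> (\<integral>\<omega>. exp (additive_functional X (r *\<^sub>R f) t \<omega>) \<partial>P x) / exp (r * (t * u))" for x
  proof -
    interpret prob_space "P x" by (rule prob_space_P)
    have exp_m: "(\<lambda>\<omega>. exp (r * ?A \<omega>)) \<in> borel_measurable (P x)"
      unfolding measurable_P using additive_functional_measurable[OF t] by simp
    have "measure (P x) {\<omega> \<in> space M. ?A \<omega> / t \<ge> u}
        \<le> measure (P x) {\<omega> \<in> space (P x). exp (r * ?A \<omega>) \<ge> exp (r * (t * u))}"
    proof (rule finite_measure_mono)
      show "{\<omega> \<in> space M. ?A \<omega> / t \<ge> u} \<subseteq> {\<omega> \<in> space (P x). exp (r * ?A \<omega>) \<ge> exp (r * (t * u))}"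
        using t r(1) by (auto simp: space_P pos_le_divide_eq mult.commute[of u] intro: mult_left_mono)
      show "{\<omega> \<in> space (P x). exp (r * ?A \<omega>) \<ge> exp (r * (t * u))} \<in> events"
        using exp_m by measurable
    qed
    also have "\<dots> \<le> (\<integral>\<omega>. exp (r * ?A \<omega>) \<partial>P x) / exp (r * (t * u))"
      using exponential_moment_limit(1)[OF t, of x "r *\<^sub>R f"]
      by (intro integral_Markov_inequality_measure[where A = "{}"])
        (auto simp: additive_functional_scaleR)
    finally show ?thesis by (simp add: additive_functional_scaleR)
  qed
  then have "prob_from P \<nu> {\<omega> \<in> space M. ?A \<omega> / t \<ge> u}
      \<le> (\<Sum>x\<in>UNIV. pmf \<nu> x * ((\<integral>\<omega>. exp (additive_functional X (r *\<^sub>R f) t \<omega>) \<partial>P x) / exp (r * (t * u))))"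
    unfolding prob_from_def by (intro sum_mono mult_left_mono) auto
  also have "\<dots> = (\<Sum>x\<in>UNIV. pmf \<nu> x * (\<integral>\<omega>. exp (additive_functional X (r *\<^sub>R f) t \<omega>) \<partial>P x))
      / exp (r * (t * u))"
    by (simp add: sum_divide_distrib)
  also have "\<dots> \<le> norm_pi \<pi> (density_wrt \<nu> \<pi>) * exp (t * \<Gamma>) / exp (r * (t * u))"
    by (intro divide_right_mono exponential_moment_le[OF erg gen t form \<Gamma>]) simp
  also have "\<dots> = norm_pi \<pi> (density_wrt \<nu> \<pi>) * exp (- (t * (r * u - \<Gamma>)))"
    unfolding times_divide_eq_right[symmetric] exp_diff[symmetric]
    by (rule arg_cong[where f = "\<lambda>z. _ * exp z"]) (simp add: algebra_simps)
  finally show ?thesis unfolding \<Gamma>_def .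
qed

end


section \<open>The Legendre transform of the rate function\<close>

text \<open>In the variable \<open>x = 1 - 2 (F / l) r\<close>, and with \<open>u\<close> expressed through the square root \<open>s\<close>, the
  objective becomes an increasing affine function of \<open>- (x s\<^sup>2 + 1 / x)\<close>. Its unconstrained maximum is at
  \<open>x = 1 / s\<close>, that is \<open>r = r\<^sub>0\<close>; the constraint \<open>r \<le> l / (3 F)\<close> is \<open>x \<ge> 1 / 3\<close>.\<close>

locale rate_parameters =
  fixes l F v u :: real
  assumes l: "l > 0" and F: "F > 0" and v: "v > 0" and u: "u \<ge> 0"
begin

definition s where "s = sqrt (1 + 4 * u * F / (l * v))"

lemma s_sq: "s\<^sup>2 = 1 + 4 * u * F / (l * v)"
  using l F v u by (simp add: s_def)

lemma s_ge_1: "s \<ge> 1"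
  using l F v u by (simp add: s_def)

lemma u_eq: "u = l * v * (s\<^sup>2 - 1) / (4 * F)"
  using l F v by (simp add: s_sq)

lemma r_zero_eq: "r_zero l F v u = l / (2 * F) * (1 - 1 / s)"
proof -
  have "1 + 4 * u * F / (l * v) > 0" using l F v u by (simp add: add_pos_nonneg)
  then have "(1 + 4 * u * F / (l * v)) powr (- 1 / 2) = 1 / s"
    using powr_minus[of "1 + 4 * u * F / (l * v)" "1 / 2"]
    by (simp add: s_def powr_half_sqrt inverse_eq_divide)
  then show ?thesis by (simp add: r_zero_def)
qed

lemma denominator_eq: "1 - 2 * (F / l) * (l / (2 * F) * (1 - x)) = x"
  using l F by (simp add: field_simps)

lemma objective_eq:
  assumes "x > 0"
  shows "l / (2 * F) * (1 - x) * u - G_fun l F v (l / (2 * F) * (1 - x))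
    = v * l\<^sup>2 / (8 * F\<^sup>2) * (s\<^sup>2 + 1 - (x * s\<^sup>2 + 1 / x))"
  unfolding G_fun_def denominator_eq
  by (subst u_eq) (use l F assms in \<open>simp add: field_simps power2_eq_square\<close>)

lemma objective_le:
  assumes "x > 0" "y > 0" and "x * s\<^sup>2 + 1 / x \<le> y * s\<^sup>2 + 1 / y"
  shows "l / (2 * F) * (1 - y) * u - G_fun l F v (l / (2 * F) * (1 - y))
    \<le> l / (2 * F) * (1 - x) * u - G_fun l F v (l / (2 * F) * (1 - x))"
  unfolding objective_eq[OF assms(1)] objective_eq[OF assms(2)]
  using assms(3) v by (intro mult_left_mono) auto

lemma endpoint_eq: "l / (3 * F) = l / (2 * F) * (1 - 1 / 3)"
  by simp

lemma G_star_eqI: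
  assumes x: "1 / 3 \<le> x" "x \<le> 1" and min: "\<And>y. 1 / 3 \<le> y \<Longrightarrow> x * s\<^sup>2 + 1 / x \<le> y * s\<^sup>2 + 1 / y"
  defines "r \<equiv> l / (2 * F) * (1 - x)"
  shows "G_star l F v u = r * u - G_fun l F v r"
  unfolding G_star_def
proof (rule cSup_eq_maximum)
  have "r \<in> {0..l / (3 * F)}"
    unfolding endpoint_eq r_def atLeastAtMost_iff
    using x l F by (intro conjI mult_nonneg_nonneg mult_left_mono) auto
  then show "r * u - G_fun l F v r \<in> (\<lambda>r. r * u - G_fun l F v r) ` {0..l / (3 * F)}" by blast
  fix z assume "z \<in> (\<lambda>r. r * u - G_fun l F v r) ` {0..l / (3 * F)}"
  then obtain r' where r': "r' \<le> l / (3 * F)" and z: "z = r' * u - G_fun l F v r'" by auto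
  define y where "y = 1 - 2 * (F / l) * r'"
  have "r' = l / (2 * F) * (1 - y)" using l F by (simp add: y_def)
  moreover have "1 / 3 \<le> y" using r' l F by (simp add: y_def field_simps)
  ultimately show "z \<le> r * u - G_fun l F v r"
    unfolding z r_def using objective_le[of x y] x min[of y] by simp
qed

lemma r_zero_le_iff: "r_zero l F v u \<le> l / (3 * F) \<longleftrightarrow> s \<le> 3"
proof -
  have "r_zero l F v u \<le> l / (3 * F) \<longleftrightarrow> 1 - 1 / s \<le> 1 - 1 / 3"
    unfolding r_zero_eq endpoint_eq using l F by (intro mult_le_cancel_left_pos) simp
  also have "\<dots> \<longleftrightarrow> s \<le> 3" using s_ge_1 by (simp add: field_simps)
  finally show ?thesis .
qed

lemma u_le_iff: "u \<le> 2 * v * l / F \<longleftrightarrow> s \<le> 3"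
proof -
  have "s \<le> 3 \<longleftrightarrow> s\<^sup>2 \<le> 3\<^sup>2" using s_ge_1 abs_le_square_iff[of s 3] by simp
  also have "\<dots> \<longleftrightarrow> u \<le> 2 * v * l / F"
    unfolding s_sq using l F v by (simp add: field_simps)
  finally show ?thesis by simp
qed

lemma G_star_interior:
  assumes "s \<le> 3"
  shows "G_star l F v u = r_zero l F v u * u - G_fun l F v (r_zero l F v u)"
  unfolding r_zero_eq
proof (rule G_star_eqI)
  fix y :: real assume "1 / 3 \<le> y"
  then have "y > 0" by linarith
  then have "y * s\<^sup>2 + 1 / y - 2 * s = (y * s - 1)\<^sup>2 / y"
    by (simp add: field_simps power2_eq_square)
  also have "\<dots> \<ge> 0" using \<open>y > 0\<close> by simp
  finally show "1 / s * s\<^sup>2 + 1 / (1 / s) \<le> y * s\<^sup>2 + 1 / y"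
    using s_ge_1 by (simp add: power2_eq_square)
qed (use s_ge_1 assms in \<open>auto simp: field_simps\<close>)

lemma G_star_boundary:
  assumes "s > 3"
  shows "G_star l F v u = l / (3 * F) * u - G_fun l F v (l / (3 * F))"
  unfolding endpoint_eq
proof (rule G_star_eqI)
  fix y :: real assume y: "1 / 3 \<le> y"
  then have "y > 0" by linarith
  have "3 / y \<le> 3\<^sup>2" using y \<open>y > 0\<close> by (simp add: field_simps)
  also have "\<dots> \<le> s\<^sup>2" using assms by (intro power_mono) auto
  finally have "0 \<le> (y - 1 / 3) * (s\<^sup>2 - 3 / y)" using y by simp
  also have "\<dots> = y * s\<^sup>2 + 1 / y - (1 / 3 * s\<^sup>2 + 1 / (1 / 3))"
    using \<open>y > 0\<close> by (simp add: field_simps)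
  finally show "1 / 3 * s\<^sup>2 + 1 / (1 / 3) \<le> y * s\<^sup>2 + 1 / y" by simp
qed auto

lemma value_interior:
  "r_zero l F v u * u - G_fun l F v (r_zero l F v u) = 2 * u\<^sup>2 / (v * (1 + s)\<^sup>2)"
proof -
  have "s > 0" using s_ge_1 by linarith
  have "r_zero l F v u * u - G_fun l F v (r_zero l F v u) = v * l\<^sup>2 / (8 * F\<^sup>2) * (s - 1)\<^sup>2"
    unfolding r_zero_eq using objective_eq[of "1 / s"] \<open>s > 0\<close>
    by (simp add: power2_eq_square algebra_simps)
  moreover have "u = l * v / (4 * F) * (s - 1) * (1 + s)"
    by (subst u_eq) (simp add: power2_eq_square algebra_simps)
  then have "u\<^sup>2 = (l * v / (4 * F) * (s - 1))\<^sup>2 * (1 + s)\<^sup>2" by (metis power_mult_distrib)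
  then have "2 * u\<^sup>2 / (v * (1 + s)\<^sup>2) = 2 * (l * v / (4 * F) * (s - 1))\<^sup>2 / v"
    using \<open>s > 0\<close> by simp
  moreover have "2 * (l * v / (4 * F) * (s - 1))\<^sup>2 / v = v * l\<^sup>2 / (8 * F\<^sup>2) * (s - 1)\<^sup>2"
    using F v by (simp add: power_mult_distrib power_divide) (simp add: power2_eq_square)
  ultimately show ?thesis by simp
qed

lemma value_boundary:
  "l / (3 * F) * u - G_fun l F v (l / (3 * F)) = l / (3 * F) * (u - l * v / (2 * F))"
  using l F by (simp add: G_fun_def field_simps power2_eq_square)

end


section \<open>The concentration inequality\<close>

theorem theorem3p3p20:
  fixes M :: "'w measure" and P :: "'e::finite \<Rightarrow> 'w measure" and X :: "real \<Rightarrow> 'w \<Rightarrow> 'e"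
    and Q :: "real ^ 'e ^ 'e" and \<pi> \<nu> :: "'e pmf" and f :: "real ^ 'e" and u t :: real
  defines "l \<equiv> spectral_gap \<pi> Q"
    and "F \<equiv> infnorm f"
    and "v \<equiv> sigma_hat_sq \<pi> Q f"
  defines "r0 \<equiv> r_zero l F v u"
  assumes card: "CARD('e) \<ge> 2"
    and mjp: "markov_jump_process M P X"
    and irred: "irreducible_process P X"
    and gen: "generator_matrix P X Q"
    and inv: "invariant_distribution Q \<pi>"
    and nonconst: "\<not> (\<exists>c. \<forall>x. f $ x = c)"
    and centered: "mean \<pi> f = 0"
    and u: "u \<ge> 0" and t: "t > 0"
  shows
    "(r0 \<le> l / (3 * F) \<longleftrightarrow> u \<le> 2 * v * l / F) \<and>
     (r0 \<le> l / (3 * F) \<longrightarrow>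
        G_star l F v u = r0 * u - G_fun l F v r0 \<and>
        prob_from P \<nu> {\<omega> \<in> space M. additive_functional X f t \<omega> / t \<ge> u}
          \<le> norm_pi \<pi> (density_wrt \<nu> \<pi>) *
             exp (- (2 * t * u\<^sup>2 / (v * (1 + sqrt (1 + 4 * F * u / (l * v)))\<^sup>2)))) \<and>
     (r0 > l / (3 * F) \<longleftrightarrow> u > 2 * v * l / F) \<and>
     (r0 > l / (3 * F) \<longrightarrow>
        G_star l F v u = l / (3 * F) * u - G_fun l F v (l / (3 * F)) \<and>
        prob_from P \<nu> {\<omega> \<in> space M. additive_functional X f t \<omega> / t \<ge> u}
          \<le> norm_pi \<pi> (density_wrt \<nu> \<pi>) *
             exp (- (t * (l / (3 * F)) * (u - l * v / (2 * F)))))"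
proof -
  interpret markov_jump_process M P X by (rule mjp)
  have "matrix_exp Q $ x $ y > 0" for x y
    using irred gen[unfolded generator_matrix_def] unfolding irreducible_process_def
    by (metis scaleR_one zero_le_one zero_less_one)
  then have erg: "ergodic_generator Q \<pi>"
    using gen inv card by (intro ergodic_generator_if_positive) (auto simp: generator_matrix_def)
  interpret ergodic_generator Q \<pi> by (rule erg)
  have "f \<noteq> 0" using nonconst by auto
  interpret rate_parameters l F v u
    using spectral_gap_pos sigma_hat_sq_pos[OF centered \<open>f \<noteq> 0\<close>] u \<open>f \<noteq> 0\<close>
    by unfold_locales (simp_all add: l_def F_def v_def infnorm_pos_lt)
  have tail: "prob_from P \<nu> {\<omega> \<in> space M. additive_functional X f t \<omega> / t \<ge> u}
      \<le> norm_pi \<pi> (density_wrt \<nu> \<pi>)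
        * exp (- (t * (l / (2 * F) * (1 - x) * u - G_fun l F v (l / (2 * F) * (1 - x)))))"
    if "0 < x" "x \<le> 1" for x
  proof -
    have "2 * (F / l) * (l / (2 * F) * (1 - x)) < 1" using denominator_eq[of x] that(1) by linarith
    moreover have "0 \<le> l / (2 * F) * (1 - x)" using l F that(2) by simp
    ultimately show ?thesis
      using tail_bound[OF erg gen t centered] by (simp only: l_def F_def v_def)
  qed
  have s: "s = sqrt (1 + 4 * F * u / (l * v))" by (simp add: s_def mult_ac)
  have interior: "prob_from P \<nu> {\<omega> \<in> space M. additive_functional X f t \<omega> / t \<ge> u}
      \<le> norm_pi \<pi> (density_wrt \<nu> \<pi>) * exp (- (2 * t * u\<^sup>2 / (v * (1 + s)\<^sup>2)))"
  proof -
    have "0 < 1 / s" "1 / s \<le> 1" using s_ge_1 by auto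
    from tail[OF this] show ?thesis
      unfolding r_zero_eq[symmetric] value_interior by (simp add: mult_ac)
  qed
  have boundary: "prob_from P \<nu> {\<omega> \<in> space M. additive_functional X f t \<omega> / t \<ge> u}
      \<le> norm_pi \<pi> (density_wrt \<nu> \<pi>) * exp (- (t * (l / (3 * F)) * (u - l * v / (2 * F))))"
    using tail[of "1 / 3"] unfolding endpoint_eq[symmetric] value_boundary by (simp add: mult_ac)
  show ?thesis
    using r_zero_le_iff u_le_iff G_star_interior G_star_boundary interior boundary
    unfolding r0_def s[symmetric] not_le[symmetric] by blast
qed

end
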